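(* For every positive integer $k$, the polynomial $\Delta_{3k,3}(c)$ is irreducible over $\mathbb{Q}$.
   Context: Let $f_c(z)=z^2+c\in\mathbb{Z}[c][z]$, and define iterates by $f_c^{\circ 0}(z)=z$, $f_c^{\circ j}=f_c\circ f_c^{\circ(j-1)}$. For $n\ge1$ the $n$-th dynatomic polynomial is $\Phi_n^*(z,c)=\prod_{j\mid n}(f_c^{\circ j}(z)-z)^{\mu(n/j)}$ ($\mu$ the Möbius function). The $n$-th multiplier polynomial $\delta_n(x,c)\in\mathbb{Z}[x,c]$ is the polynomial, monic in $x$, with $\delta_n(x,c)^n=\operatorname{Res}_z\big(\Phi_n^*(z,c),\,x-(f_c^{\circ n})'(z)\big)$. Let $\Psi_j(x)$ denote the $j$-th cyclotomic polynomial. For positive integers $m\mid n$ with $m<n$, the delta factor is $\Delta_{n,m}(c)=\operatorname{Res}_x(\Psi_{n/m}(x),\delta_m(x,c))$; and $\Delta_{n,n}(c)$ is defined by $\delta_n(1,c)=\Delta_{n,n}(c)\prod_{m\mid n,\,m\neq n}\Delta_{n,m}(c)$. *)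

theory Defs
  imports "HOL-Computational_Algebra.Computational_Algebra" "Subresultants.Resultant_Prelim"
begin

definition moebius_mu :: "nat \<Rightarrow> int" where
  "moebius_mu n = (if n = 0 \<or> \<not> squarefree n then 0
                   else (-1) ^ card (prime_factors n))"

(* Product formula prod_{j | n} g(j)^{mu(n/j)}, realised as exact quotient
   (numerator: mu = 1, denominator: mu = -1) in an integral domain. *)
definition moebius_prod :: "nat \<Rightarrow> (nat \<Rightarrow> 'a :: idom_divide) \<Rightarrow> 'a" where
  "moebius_prod n g =
     (\<Prod>j\<in>{j. j dvd n \<and> moebius_mu (n div j) = 1}. g j) div
     (\<Prod>j\<in>{j. j dvd n \<and> moebius_mu (n div j) = -1}. g j)"

definition cyclo :: "nat \<Rightarrow> int poly" where
  "cyclo j = moebius_prod j (\<lambda>d. monom 1 d - 1)"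

(* Bivariate polynomials in Z[c][z]: outer variable z, coefficients in Z[c]
   (inner variable c).  f_c(z) = z^2 + c. *)
definition fc :: "int poly poly" where
  "fc = [: [:0, 1:], 0, 1 :]"

fun fc_iter :: "nat \<Rightarrow> int poly poly" where
  "fc_iter 0 = [:0, 1:]"
| "fc_iter (Suc j) = pcompose fc (fc_iter j)"

definition dynatomic :: "nat \<Rightarrow> int poly poly" where
  "dynatomic n = moebius_prod n (\<lambda>j. fc_iter j - [:0, 1:])"

(* Res_z(Phi_n^*(z,c), x - (f_c^{o n})'(z)) as an element of Z[c][x]
   (type int poly poly: outer variable x, inner variable c).
   Polynomials in z with coefficients in Z[c][x] have type int poly poly poly. *)
definition mult_res :: "nat \<Rightarrow> int poly poly" where
  "mult_res n = resultant
      (map_poly (\<lambda>a. [:a:]) (dynatomic n))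
      ([: [:0, 1:] :] - map_poly (\<lambda>a. [:a:]) (pderiv (fc_iter n)))"

definition delta :: "nat \<Rightarrow> int poly poly" where
  "delta n = (THE d. lead_coeff d = 1 \<and> d ^ n = mult_res n)"

definition Delta :: "nat \<Rightarrow> nat \<Rightarrow> int poly" where
  "Delta n m =
     (if m = n then
        poly (delta n) 1 div
          (\<Prod>m'\<in>{m'. m' dvd n \<and> m' \<noteq> n}.
              resultant (map_poly (\<lambda>a. [:a:]) (cyclo (n div m'))) (delta m'))
      else resultant (map_poly (\<lambda>a. [:a:]) (cyclo (n div m))) (delta m))"

end

theory Submission
  imports Defs "Subresultants.Subresultant_Gcd" "HOL-Computational_Algebra.Field_as_Ring"
begin

text \<open>
  Over the double cover $4c = -(t^2+7)$ of the parameter plane the two 3-cycles are rational, with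
  multipliers $L(t)$ and $L(-t)$ for $L(t) = 1 - 7t - t^2 - t^3$ (below: mult_poly).  Hence for $k \ge 2$ the polynomial
  $\Delta_{3k,3}$ pulls back to $F(t) F(-t)$ with $F = \Psi_k \circ L$ (below: cyclo_mult), and it suffices that $F$ is
  irreducible and not associated to $F(-t)$.

  Irreducibility of $F$ amounts to $L(t) = \zeta$ having no root $t$ in $\mathbb{Q}(\zeta)$.  Given such a root, put
  $u = t^2 + t + 7$, so that $t u = 1 - \zeta$.  The element $\gamma = (u - \bar u)/(1 - \zeta)$ is an algebraic
  integer, because complex conjugation is trivial modulo $1 - \zeta$, and an elementary estimate gives
  $|\gamma| < 1$ in every complex embedding.  So $\gamma = 0$, i.e. $u$ is real; for non-real $\zeta$ this forces
  $|1 - \zeta| < 1$ for all conjugates, which contradicts the integrality of the norm of $1 - \zeta$.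
\<close>

text \<open>The main obstacle is that u is only known to be an algebraic integer, while its
  congruence with the conjugate modulo 1 - \<zeta> is immediate only in Z[\<zeta>]. The full theorem
  that Z[\<zeta>] is the ring of integers is bypassed: if k is not a prime power, then 1 - \<zeta>
  is a unit, and if k is a power of p, it is enough that Z[\<zeta>] is maximal at p. The coordinate
  comes from the sum w of the points of a 3-cycle: c = -(w^2 + w + 2), the other cycle has sum -1 -
  w, and t = 2w + 1 turns this exchange into t -> -t. A factor of the polynomial in c pulls back to
  an even polynomial, so it contains F(t) and F(-t) together. That these are not associated is a
  size argument: the three roots of L(t) = \<zeta> have second elementary symmetric function 7, too
  large if L also took values of modulus 1 at their negatives. Two values of k stand apart. For k =
  2, \<zeta> = -1 is real, and a real root would be an integer strictly between 0 and 1. For k = 1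
  the factor is 4c + 7, whose root is the branch point of the cover.\<close>

hide_const (open) Module.smult

section \<open>Resultants over the complex numbers\<close>

lemma prod_mset_neg_diff:
  fixes A B :: "'a :: comm_ring_1 multiset"
  shows "(\<Prod>x\<in>#A. \<Prod>y\<in>#B. x - y) = (-1) ^ (size A * size B) * (\<Prod>y\<in>#B. \<Prod>x\<in>#A. y - x)"
proof -
  have 1: "(\<Prod>y\<in>#B. x - y) = (-1) ^ size B * (\<Prod>y\<in>#B. y - x)" for x
    by (induction B) (auto simp: algebra_simps)
  have "(\<Prod>x\<in>#A. \<Prod>y\<in>#B. x - y) = (-1) ^ (size A * size B) * (\<Prod>x\<in>#A. \<Prod>y\<in>#B. y - x)"
    unfolding 1 by (induction A) (auto simp: algebra_simps power_add)
  also have "(\<Prod>x\<in>#A. \<Prod>y\<in>#B. y - x) = (\<Prod>y\<in>#B. \<Prod>x\<in>#A. y - x)"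
    by (rule prod_mset.swap)
  finally show ?thesis .
qed

lemma poly_complex_proots:
  fixes g :: "complex poly"
  shows "poly g x = lead_coeff g * (\<Prod>y\<in>#proots g. x - y)"
proof -
  have "g = smult (lead_coeff g) (\<Prod>y\<in>#proots g. [:-y, 1:])"
    by (rule complex_poly_decompose_multiset[symmetric])
  then have "poly g x = lead_coeff g * poly (\<Prod>y\<in>#proots g. [:-y, 1:]) x"
    by (metis poly_smult)
  also have "poly (\<Prod>y\<in>#proots g. [:-y, 1:]) x = (\<Prod>y\<in>#proots g. x - y)"
    by (simp add: poly_prod_mset image_mset.compositionality o_def)
  finally show ?thesis .
qed

lemma prod_proots_swap:
  fixes f g :: "complex poly"
  assumes "f \<noteq> 0" "g \<noteq> 0"
  shows "lead_coeff f ^ degree g * (\<Prod>x\<in>#proots f. poly g x) =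
    (-1) ^ (degree f * degree g) * (lead_coeff g ^ degree f * (\<Prod>x\<in>#proots g. poly f x))"
proof -
  have *: "(\<Prod>x\<in>#A. c * h x) = c ^ size A * (\<Prod>x\<in>#A. h x)" for c :: complex and h and A :: "complex multiset"
    by (induction A) (auto simp: algebra_simps)
  show ?thesis
    unfolding poly_complex_proots[of g] poly_complex_proots[of f] * size_proots_complex
    by (subst prod_mset_neg_diff) (simp add: size_proots_complex mult_ac)
qed

text \<open>One Euclidean step. The resultant is the subresultant of index 0, so the Brown-Traub
  reduction lemmas apply, one for a nonconstant and one for a constant remainder.\<close>

lemma resultant_mod:
  fixes f g :: "'a :: field poly"
  assumes "degree f \<ge> degree g" "degree g > 0"
  shows "resultant f g = (-1) ^ (degree f * degree g) * lead_coeff g ^ (degree f - degree (f mod g))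
           * resultant g (f mod g)"
proof -
  define h where "h = f mod g"
  have eq: "f + (- (f div g)) * g = h"
    by (simp add: h_def algebra_simps minus_div_mult_eq_mod)
  have g0: "g \<noteq> 0" using assms by auto
  \<comment> \<open>The free disjunct \<open>b\<close> lets this fact match the disjunctive side
    conditions of both reduction lemmas.\<close>
  have h: "degree g > degree h \<or> b" for b
    using degree_mod_less[OF g0, of f] assms unfolding h_def by (cases "f mod g = 0") auto
  show ?thesis
  proof (cases "degree h = 0")
    case False
    then show ?thesis
      using BT_lemma_1_12[OF eq assms(1) h, of 0] by (simp add: subresultant_resultant h_def)
  next
    case True
    then obtain c where c: "h = [:c:]" by (meson degree_eq_zeroE)
    have "subresultant 0 f g = smult ((-1) ^ (degree f * degree g) * lead_coeff g ^ degree f * c ^ (degree g - 1)) [:c:]"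
      using BT_lemma_1_13[OF eq assms(1) h h] c by simp
    moreover have "c ^ degree g = c ^ (degree g - 1) * c"
      using assms(2) by (metis power_minus_mult)
    ultimately show ?thesis
      using c by (simp add: subresultant_resultant h_def[symmetric])
  qed
qed

text \<open>Poisson's formula by the Euclidean algorithm: f and \<open>f mod g\<close> agree at the
  roots of g, so both sides obey the same reduction rule. They also obey the same sign rule when f
  and g are exchanged, which covers the case of smaller degree on the left.\<close>

theorem resultant_eq_prod_proots:
  fixes f g :: "complex poly"
  assumes "f \<noteq> 0"
  shows "resultant f g = lead_coeff f ^ degree g * (\<Prod>x\<in>#proots f. poly g x)"
  using assms
proof (induction "degree f + degree g" arbitrary: f g rule: less_induct)
  case less
  have main: "resultant f g = lead_coeff f ^ degree g * (\<Prod>x\<in>#proots f. poly g x)"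
    if d: "degree f \<ge> degree g" "degree g > 0" "f \<noteq> 0" 
      and IH: "\<And>h. degree h < degree g \<Longrightarrow> resultant g h = lead_coeff g ^ degree h * (\<Prod>x\<in>#proots g. poly h x)"
    for f g :: "complex poly"
  proof -
    have g0: "g \<noteq> 0" using d by auto
    have dh: "degree (f mod g) < degree g"
      using degree_mod_less[OF g0, of f] d by (cases "f mod g = 0") auto
    have "poly (f mod g) x = poly f x" if "x \<in># proots g" for x
    proof -
      have "poly g x = 0" using that g0 by simp
      moreover have "poly f x = poly (f div g * g + f mod g) x" by simp
      ultimately show ?thesis by (simp only: poly_add poly_mult) simp
    qed
    then have *: "(\<Prod>x\<in>#proots g. poly (f mod g) x) = (\<Prod>x\<in>#proots g. poly f x)"
      by (metis (no_types, lifting) image_mset_cong)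
    have "resultant f g = (-1) ^ (degree f * degree g) * lead_coeff g ^ (degree f - degree (f mod g)) *
       (lead_coeff g ^ degree (f mod g) * (\<Prod>x\<in>#proots g. poly f x))"
      using resultant_mod[OF d(1,2)] IH[OF dh] * by simp
    also have "\<dots> = (-1) ^ (degree f * degree g) * (lead_coeff g ^ degree f * (\<Prod>x\<in>#proots g. poly f x))"
      using dh d(1) by (simp add: power_add[symmetric])
    also have "\<dots> = lead_coeff f ^ degree g * (\<Prod>x\<in>#proots f. poly g x)"
      by (rule prod_proots_swap[OF d(3) g0, symmetric])
    finally show ?thesis .
  qed
  consider "degree g = 0" | "degree f = 0" "degree g > 0" | "degree f > 0" "degree g > 0" by auto
  then show ?case
  proof cases
    case 1
    then obtain c where "g = [:c:]"  by (meson degree_eq_zeroE)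
    moreover have "poly [:c:] = (\<lambda>_. c)" by auto
    ultimately show ?thesis by (simp add: size_proots_complex image_mset_const_eq)
  next
    case 2
    then obtain c where "f = [:c:]" by (meson degree_eq_zeroE)
    then show ?thesis by simp
  next
    case 3
    show ?thesis
    proof (cases "degree f \<ge> degree g")
      case True
      show ?thesis
      proof (rule main[OF True 3(2) less(2)])
        fix h :: "complex poly" assume "degree h < degree g"
        then show "resultant g h = lead_coeff g ^ degree h * (\<Prod>x\<in>#proots g. poly h x)"
          using less(1)[of g h] True 3 by force
      qed
    next
      case False
      have g0: "g \<noteq> 0" using 3 by auto
      have "resultant g f = lead_coeff g ^ degree f * (\<Prod>x\<in>#proots g. poly f x)"
      proof (rule main[OF _ 3(1) g0])
        show "degree f \<le> degree g" using False by simp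
        fix h :: "complex poly" assume "degree h < degree f"
        then show "resultant f h = lead_coeff f ^ degree h * (\<Prod>x\<in>#proots f. poly h x)"
          using less(1)[of f h] False less(2) by force
      qed
      then show ?thesis
        using resultant_swap[of f g] prod_proots_swap[OF less(2) g0] by simp
    qed
  qed
qed

section \<open>Primitive roots of unity\<close>

text \<open>Division by the monic D is possible over the small ring, and its remainder must vanish
  because over the large ring it is a multiple of D of smaller degree. Hence a quotient found over
  the complex numbers already has integer coefficients.\<close>

lemma (in inj_idom_hom) dvd_of_map_poly_dvd:
  assumes "lead_coeff D = 1" and "map_poly hom N = C * map_poly hom D"
  shows "\<exists>q. N = q * D \<and> map_poly hom q = C"
proof -
  interpret mp: map_poly_inj_idom_hom hom ..
  have D0: "D \<noteq> 0" using assms(1) by auto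
  obtain q r where qr: "pseudo_divmod N D = (q, r)" by force
  have N: "N = D * q + r" and r: "r = 0 \<or> degree r < degree D"
    using pseudo_divmod[OF D0 qr] assms(1) by auto
  have eq: "map_poly hom r = (C - map_poly hom q) * map_poly hom D"
    using assms(2) unfolding N by (simp add: mp.hom_add mp.hom_mult algebra_simps)
  have "C - map_poly hom q = 0"
  proof (rule ccontr)
    assume *: "C - map_poly hom q \<noteq> 0"
    have "map_poly hom D \<noteq> 0" using D0 by simp
    then have "degree (map_poly hom r) \<ge> degree (map_poly hom D)" "map_poly hom r \<noteq> 0"
      using eq * by (simp_all add: degree_mult_eq)
    then show False using r by auto
  qed
  then have "C = map_poly hom q" "r = 0" using eq by auto
  then show ?thesis using N by (auto intro!: exI[of _ q] simp: mult.commute)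
qed

section \<open>Evaluation of integer polynomials at complex numbers\<close>

abbreviation evi :: "int poly \<Rightarrow> complex \<Rightarrow> complex" where
  "evi P z \<equiv> poly (map_poly of_int P) z"

lemma evi_simps [simp]:
  "evi (P + Q) z = evi P z + evi Q z"
  "evi (P - Q) z = evi P z - evi Q z"
  "evi (P * Q) z = evi P z * evi Q z"
  "evi (- P) z = - evi P z"
  "evi (P ^ n) z = evi P z ^ n"
  "evi [:c:] z = of_int c"
  "evi (monom c n) z = of_int c * z ^ n"
  "evi 1 z = 1"
  "evi (smult c P) z = of_int c * evi P z"
  by (simp_all add: hom_distribs poly_monom)

lemma evi_pcompose [simp]: "evi (pcompose P Q) z = evi P (evi Q z)"
  by (simp add: of_int_hom.map_poly_pcompose poly_pcompose)

lemma evi_eq_0_if_dvd: "P dvd Q \<Longrightarrow> evi P z = 0 \<Longrightarrow> evi Q z = 0"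
  by (auto elim!: dvdE)

definition prim_roots :: "nat \<Rightarrow> complex set" where
  "prim_roots k = {z. z ^ k = 1 \<and> (\<forall>m. 0 < m \<and> m < k \<longrightarrow> z ^ m \<noteq> 1)}"

lemma prim_roots_power_eq_1_iff:
  assumes "z \<in> prim_roots k" "k > 0"
  shows "z ^ m = 1 \<longleftrightarrow> k dvd m"
proof -
  have "z ^ m = z ^ (k * (m div k) + m mod k)" by simp
  also have "\<dots> = z ^ (m mod k)"
    using assms by (simp only: power_add power_mult) (simp add: prim_roots_def)
  finally have "z ^ m = z ^ (m mod k)" .
  moreover have "z ^ (m mod k) = 1 \<longleftrightarrow> m mod k = 0"
    using assms by (cases "m mod k = 0") (auto simp: prim_roots_def)
  ultimately show ?thesis by (simp add: dvd_eq_mod_eq_0)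
qed

lemma finite_prim_roots: "k > 0 \<Longrightarrow> finite (prim_roots k)"
  by (rule finite_subset[OF _ finite_roots_unity[of k]]) (auto simp: prim_roots_def)

lemma prim_roots_nonzero: "z \<in> prim_roots k \<Longrightarrow> k > 0 \<Longrightarrow> z \<noteq> 0"
  by (auto simp: prim_roots_def zero_power)

lemma prim_roots_norm: "z \<in> prim_roots k \<Longrightarrow> k > 0 \<Longrightarrow> norm z = 1"
  unfolding prim_roots_def by (metis (mono_tags, lifting) mem_Collect_eq norm_one norm_power power_eq_1_iff less_numeral_extra(3) norm_ge_zero)

text \<open>The first k powers of z are distinct, and there are only k roots of unity of order
  dividing k.\<close>

lemma prim_roots_generate:
  assumes "z \<in> prim_roots k" "k > 0" "w ^ k = 1"
  shows "\<exists>j<k. w = z ^ j"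
proof -
  have inj: "inj_on (\<lambda>j. z ^ j) {..<k}"
  proof (rule linorder_inj_onI')
    fix i j assume ij: "i \<in> {..<k}" "j \<in> {..<k}" "i < j"
    show "z ^ i \<noteq> z ^ j"
    proof
      assume "z ^ i = z ^ j"
      also have "z ^ j = z ^ i * z ^ (j - i)" using ij by (simp add: power_add[symmetric])
      finally have "z ^ (j - i) = 1" using prim_roots_nonzero[OF assms(1,2)] by simp
      then show False using ij assms(1) unfolding prim_roots_def by auto
    qed
  qed
  have "(\<lambda>j. z ^ j) ` {..<k} = {w. w ^ k = 1}"
  proof (rule card_subset_eq)
    show "finite {w::complex. w ^ k = 1}" using assms(2) by (intro finite_roots_unity) simp
    show "(\<lambda>j. z ^ j) ` {..<k} \<subseteq> {w. w ^ k = 1}"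
      using assms(1) by (auto simp: prim_roots_def power_commutes power_mult[symmetric] mult.commute[of _ k])
        (simp add: power_mult)
    show "card ((\<lambda>j. z ^ j) ` {..<k}) = card {w::complex. w ^ k = 1}"
      using card_image[OF inj] card_roots_unity_eq[OF assms(2)] by simp
  qed
  then show ?thesis using assms(3) by auto
qed

lemma prim_roots_power:
  assumes "z \<in> prim_roots k" "k > 0"
  shows "z ^ j \<in> prim_roots k \<longleftrightarrow> coprime j k"
proof
  assume "coprime j k"
  have "(z ^ j) ^ m = 1 \<longleftrightarrow> k dvd m" for m
    using prim_roots_power_eq_1_iff[OF assms, of "j * m"] \<open>coprime j k\<close>
    by (simp add: power_mult coprime_commute coprime_dvd_mult_right_iff)
  then show "z ^ j \<in> prim_roots k" by (auto simp: prim_roots_def dest: nat_dvd_not_less)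
next
  assume *: "z ^ j \<in> prim_roots k"
  define g where "g = gcd j k"
  have "(z ^ j) ^ (k div g) = 1"
  proof -
    have "k dvd j * (k div g)"
      unfolding g_def by (metis dvd_div_mult dvd_triv_right gcd_dvd1 gcd_dvd2 mult.commute)
    then show ?thesis using prim_roots_power_eq_1_iff[OF assms, of "j * (k div g)"] by (simp add: power_mult)
  qed
  then have "k dvd k div g" using prim_roots_power_eq_1_iff[OF * assms(2)] by simp
  moreover have g: "g > 0" "g dvd k" using assms(2) by (simp_all add: g_def)
  then have "k div g > 0" using assms(2) by (auto elim!: dvdE)
  ultimately have "k \<le> k div g" by (rule dvd_imp_le)
  then have "\<not> g > 1" using div_less_dividend[of g k] assms(2) by linarith
  then have "g = 1" using g(1) by simp
  then show "coprime j k" by (simp add: g_def coprime_iff_gcd_eq_1)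
qed

lemma prim_roots_nonempty:
  assumes "k > 0" shows "cis (2 * pi / k) \<in> prim_roots k"
proof -
  have "cis (2 * pi / k) ^ m \<noteq> 1" if "0 < m" "m < k" for m
  proof
    assume "cis (2 * pi / k) ^ m = 1"
    then have "cis (2 * pi * real m / real k) = cis (2 * pi * real 0 / real k)"
      by (simp add: DeMoivre mult_ac)
    moreover have "inj_on (\<lambda>k'. cis (2 * pi * real k' / real k)) {..<k}"
      using bij_betw_roots_unity[OF assms] by (auto simp: bij_betw_def)
    ultimately have "m = 0" using that unfolding inj_on_def by (metis lessThan_iff less_trans)
    with that show False by simp
  qed
  then show ?thesis using assms by (auto simp: prim_roots_def DeMoivre)
qed

lemma prim_roots_of_root:
  fixes w :: complex
  assumes "w ^ k = 1" "k > 0"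
  shows "\<exists>d. d dvd k \<and> d > 0 \<and> w \<in> prim_roots d"
proof -
  define d where "d = (LEAST d. d > 0 \<and> w ^ d = 1)"
  have d: "d > 0 \<and> w ^ d = 1" unfolding d_def by (rule LeastI[of _ k]) (use assms in auto)
  have min: "\<not> (m > 0 \<and> w ^ m = 1)" if "m < d" for m using not_less_Least that unfolding d_def by blast
  have "w \<in> prim_roots d" using d min by (auto simp: prim_roots_def)
  moreover have "d dvd k" using prim_roots_power_eq_1_iff[OF \<open>w \<in> prim_roots d\<close>] d assms by auto
  ultimately show ?thesis using d by blast
qed

section \<open>Galois conjugacy of primitive roots of unity\<close>

lemma prime_dvd_power_add:
  fixes a b :: "'a :: comm_ring_1"
  assumes "prime p"
  shows "of_nat p dvd (a + b) ^ p - a ^ p - b ^ p"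
proof -
  have p0: "p > 0" using assms by (simp add: prime_gt_0_nat)
  have "(a + b) ^ p = (\<Sum>i\<le>p. of_nat (p choose i) * a ^ i * b ^ (p - i))"
    by (rule binomial_ring)
  also have "{..p} = insert 0 (insert p {1..<p})" using p0 by auto
  also have "(\<Sum>i\<in>insert 0 (insert p {1..<p}). of_nat (p choose i) * a ^ i * b ^ (p - i)) =
    b ^ p + (a ^ p + (\<Sum>i\<in>{1..<p}. of_nat (p choose i) * a ^ i * b ^ (p - i)))"
    using p0 by (subst sum.insert; (subst sum.insert)?; auto)
  finally have "(a + b) ^ p - a ^ p - b ^ p = (\<Sum>i\<in>{1..<p}. of_nat (p choose i) * a ^ i * b ^ (p - i))"
    by simp
  moreover have "of_nat p dvd (of_nat (p choose i) :: 'a)" if "i \<in> {1..<p}" for i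
    using that dvd_choose_prime[of i p] assms by (auto elim!: dvdE)
  ultimately show ?thesis by (auto intro!: dvd_sum dvd_mult2)
qed

lemma prime_dvd_power_diff:
  fixes a :: int
  assumes "prime p"
  shows "of_nat p dvd a ^ p - a"
proof (induction a rule: int_induct[where k = 0])
  case base
  then show ?case using assms by (simp add: zero_power prime_gt_0_nat)
next
  case (step1 i)
  have "(i + 1) ^ p - (i + 1) = ((i + 1) ^ p - i ^ p - 1 ^ p) + (i ^ p - i)" by simp
  then show ?case using step1 prime_dvd_power_add[OF assms, of i 1] by (metis dvd_add)
next
  case (step2 i)
  have "(i - 1) ^ p - (i - 1) = (i ^ p - i) - (i ^ p - (i - 1) ^ p - 1 ^ p)" by simp
  moreover have "int p dvd (i ^ p - (i - 1) ^ p - 1 ^ p)"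
    using prime_dvd_power_add[OF assms, of "i - 1" 1] by simp
  ultimately show ?case using step2 by (simp only: dvd_diff)
qed

text \<open>Modulo p, raising to the power p is additive, and by Fermat it fixes the integers. The
  congruence therefore passes through P one coefficient at a time.\<close>

lemma prime_dvd_pcompose_power:
  fixes P :: "int poly"
  assumes "prime p"
  shows "of_nat p dvd pcompose P (monom 1 p) - P ^ p"
proof (induction P)
  case 0
  then show ?case using assms by (simp add: zero_power prime_gt_0_nat)
next
  case (pCons a P)
  have 1: "of_nat p dvd ([:a:] - [:a:] ^ p :: int poly)"
  proof -
    have "int p dvd a - a ^ p"
      using prime_dvd_power_diff[OF assms, of a] by (subst dvd_diff_commute) simp
    then have "[:int p:] dvd [:a - a ^ p:]" by (simp add: const_poly_dvd_const_poly_iff)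
    then show ?thesis by (simp add: of_nat_poly poly_const_pow)
  qed
  have 2: "of_nat p dvd (pCons a P ^ p - [:a:] ^ p - pCons 0 P ^ p)"
    using prime_dvd_power_add[OF assms, of "[:a:]" "pCons 0 P"] by simp
  have "pCons 0 P = monom 1 1 * P" by (simp add: monom_Suc)
  then have "pCons 0 P ^ p = monom 1 p * P ^ p" by (simp add: power_mult_distrib monom_power)
  then have 3: "of_nat p dvd (monom 1 p * pcompose P (monom 1 p) - pCons 0 P ^ p)"
    using dvd_mult[OF pCons.IH, of "monom 1 p"] by (simp add: right_diff_distrib)
  have "pcompose (pCons a P) (monom 1 p) - pCons a P ^ p =
     ([:a:] - [:a:] ^ p) - (pCons a P ^ p - [:a:] ^ p - pCons 0 P ^ p) + (monom 1 p * pcompose P (monom 1 p) - pCons 0 P ^ p)"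
    by (simp add: pcompose_pCons)
  then show ?case using 1 2 3 by (simp only: dvd_add dvd_diff)
qed

lemma resultant_eq_0_if_common_root:
  fixes f g :: "int poly"
  assumes "f \<noteq> 0" "evi f z = 0" "evi g z = 0"
  shows "resultant f g = 0"
proof -
  have "of_int (resultant f g) = resultant (map_poly complex_of_int f) (map_poly of_int g)"
    by (rule of_int_hom.resultant_hom[symmetric])
  also have "\<dots> = 0"
  proof -
    have "z \<in># proots (map_poly complex_of_int f)" using assms by simp
    then show ?thesis
      using assms resultant_eq_prod_proots[of "map_poly complex_of_int f" "map_poly of_int g"]
      by (auto simp: prod_mset_zero_iff image_iff)
  qed
  finally show ?thesis by simp
qed

text \<open>The minimal polynomial of z is found among the prime factors of X^k - 1 in Z[X]. If it
  were coprime to some P vanishing at z, their resultant would be nonzero despite the common root.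
  Working in Z[X] throughout keeps the divisibility integral.\<close>

lemma minimal_int_poly_exists:
  assumes "z ^ k = 1" "k > 0"
  obtains f :: "int poly" where "lead_coeff f = 1" "evi f z = 0" "f dvd monom 1 k - 1"
    "\<And>P. evi P z = 0 \<Longrightarrow> f dvd P"
proof -
  define X :: "int poly" where "X = monom 1 k - 1"
  have dX: "degree X = k" "lead_coeff X = 1"
  proof -
    have "degree X = degree (monom (1::int) k)" unfolding X_def diff_conv_add_uminus
      by (rule degree_add_eq_left) (use assms in \<open>simp add: degree_monom_eq\<close>)
    then show "degree X = k" by (simp add: degree_monom_eq)
    then show "lead_coeff X = 1" using assms by (simp add: X_def)
  qed
  have X0: "X \<noteq> 0" using dX by auto
  define A where "A = prime_factorization X"
  have A: "\<And>p. p \<in># A \<Longrightarrow> prime p" "normalize (prod_mset A) = normalize X"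
    using X0 by (auto simp: A_def in_prime_factors_imp_prime prod_mset_prime_factorization_weak)
  have dvds: "X dvd prod_mset A" "prod_mset A dvd X"
    using A(2) by (auto simp: associated_iff_dvd)
  have "evi (prod_mset A) z = 0"
    by (rule evi_eq_0_if_dvd[OF dvds(1)]) (use assms in \<open>auto simp: X_def poly_monom\<close>)
  then have "\<exists>p\<in>#A. evi p z = 0"
    by (induction A) auto
  then obtain f0 where f0: "f0 \<in># A" "evi f0 z = 0" by auto
  have pf0: "prime_elem f0" using A f0 by auto
  have "f0 dvd X" using f0(1) dvds(2) by (meson dvd_prod_mset dvd_trans)
  then obtain g where g: "X = f0 * g" by auto
  have lc: "lead_coeff f0 * lead_coeff g = 1" using dX(2) unfolding g by (simp add: lead_coeff_mult)
  \<comment> \<open>The two leading coefficients have product 1, so this scaling is by a unit and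
    makes the factor monic.\<close>
  define f where "f = smult (lead_coeff g) f0"
  have 1: "lead_coeff f = 1" using lc by (auto simp: f_def mult.commute lead_coeff_smult)
  have f_dvd: "f dvd Q" if "f0 dvd Q" for Q
  proof -
    from that obtain h where "Q = f0 * h" by auto
    moreover have "f * smult (lead_coeff f0) h = smult (lead_coeff f0 * lead_coeff g) (f0 * h)"
      by (simp add: f_def)
    ultimately have "Q = f * smult (lead_coeff f0) h" using lc by simp
    then show ?thesis by (rule dvdI)
  qed
  have "f0 dvd P" if "evi P z = 0" for P
  proof (rule ccontr)
    assume "\<not> f0 dvd P"
    then have "coprime f0 P" using pf0 by (metis prime_elem_imp_coprime)
    then have "degree (gcd f0 P) = 0" by simp
    moreover have "resultant f0 P = 0"
      by (rule resultant_eq_0_if_common_root) (use f0 that pf0 in auto)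
    ultimately show False using resultant_0_gcd[of f0 P] by simp
  qed
  then show ?thesis
    using that[of f] 1 f_dvd f0 \<open>f0 dvd X\<close> unfolding X_def by (auto simp: f_def map_poly_smult hom_distribs)
qed


text \<open>Dedekind's argument. If the minimal polynomial f does not vanish at z^p, its cofactor g
  in X^k - 1 does. Differentiating X^k - 1 = f g there gives k z^(p(k-1)) = f(z^p) g'(z^p), and
  f(z^p) is congruent to f(z)^p = 0 modulo p. So p divides k in Z[z], hence in Z.\<close>

lemma frobenius_root:
  fixes P :: "int poly"
  assumes z: "z ^ k = 1" "k > 0" and p: "prime p" "\<not> p dvd k" and P: "evi P z = 0"
  shows "evi P (z ^ p) = 0"
proof -
  obtain f where f: "lead_coeff f = 1" "evi f z = 0" "f dvd monom 1 k - 1" "\<And>P. evi P z = 0 \<Longrightarrow> f dvd P"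
    using minimal_int_poly_exists[OF z] by metis
  have degf: "degree f > 0"
  proof (rule ccontr)
    assume "\<not> degree f > 0"
    then have "f = [:1:]" using f(1) by (metis degree_eq_zeroE gr0I lead_coeff_pCons(2) pCons_0_0 coeff_pCons_0 degree_pCons_0)
    with f(2) show False by simp
  qed
  have "evi f (z ^ p) = 0"
  proof (rule ccontr)
    assume nz: "evi f (z ^ p) \<noteq> 0"
    from f(3) obtain g where g: "monom 1 k - 1 = f * g" by auto
    have "evi (monom 1 k - 1) (z ^ p) = 0"
      using z by (simp add: poly_monom flip: power_mult) (simp add: mult.commute[of p] power_mult)
    then have gz: "evi g (z ^ p) = 0" using nz unfolding g by simp
    have "pderiv (monom 1 k - 1 :: int poly) = monom (of_nat k) (k - 1)"
      by (simp add: pderiv_diff pderiv_monom)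
    then have "monom (of_nat k) (k - 1) = pderiv f * g + f * pderiv g"
      unfolding g by (simp add: pderiv_mult add.commute mult.commute)
    then have "evi (monom (of_nat k) (k - 1)) (z ^ p) = evi (pderiv f * g + f * pderiv g) (z ^ p)"
      by simp
    then have e1: "of_nat k * (z ^ p) ^ (k - 1) = evi f (z ^ p) * evi (pderiv g) (z ^ p)"
      using gz by (simp add: poly_monom)
    obtain q where q: "pcompose f (monom 1 p) - f ^ p = of_nat p * q"
      using prime_dvd_pcompose_power[OF p(1), of f] by auto
    have "evi (pcompose f (monom 1 p) - f ^ p) z = evi (of_nat p * q) z" unfolding q ..
    then have e2: "evi f (z ^ p) = of_nat p * evi q z"
      using f(2) p(1) by (simp add: poly_monom of_nat_poly zero_power prime_gt_0_nat)
    define W where "W = q * pcompose (pderiv g) (monom 1 p) * monom 1 p"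
    \<comment> \<open>The extra factor z^p completes the exponent k - 1 to k and so removes the
      power of z^p.\<close>
    have "of_nat k = of_nat k * (z ^ p) ^ k"
      using z by (simp flip: power_mult) (simp add: mult.commute[of p] power_mult)
    also have "\<dots> = (of_nat k * (z ^ p) ^ (k - 1)) * z ^ p"
      using z(2) by (simp add: power_eq_if)
    also have "\<dots> = of_nat p * evi W z"
      unfolding e1 e2 W_def by (simp add: poly_monom)
    finally have kW: "of_nat k = of_nat p * evi W z" .
    \<comment> \<open>Reducing W modulo the monic f makes p r - k a polynomial of degree below f
      that vanishes at z. It is therefore zero, and its constant coefficient gives p dvd k.\<close>
    have f0: "f \<noteq> 0" using f(1) by auto
    obtain w r where wr: "pseudo_divmod W f = (w, r)" by force
    have W: "W = f * w + r" and r: "r = 0 \<or> degree r < degree f"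
      using pseudo_divmod[OF f0 wr] f(1) by auto
    have "evi (smult (int p) r - [:int k:]) z = 0"
      using kW f(2) unfolding W by (simp add: hom_distribs)
    then have "f dvd smult (int p) r - [:int k:]" by (rule f(4))
    moreover have "degree (smult (int p) r - [:int k:]) < degree f"
      using r degf by (auto intro!: degree_diff_less)
    ultimately have "smult (int p) r - [:int k:] = 0"
      using dvd_imp_degree_le leD by blast
    then have "coeff (smult (int p) r) 0 = coeff [:int k:] 0" by simp
    then have "int k = int p * coeff r 0" by simp
    then have "p dvd k" by (metis dvd_triv_left int_dvd_int_iff)
    with p(2) show False by simp
  qed
  then show ?thesis using f(4)[OF P] by (rule evi_eq_0_if_dvd[rotated])
qed

text \<open>Irreducibility of the cyclotomic polynomial in the form used below. Two primitive roots
  differ by an exponent j prime to k, and z^j is reached through the prime factors of j one at a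
  time.\<close>

theorem conjugate_root:
  fixes P :: "int poly"
  assumes "k > 0" "z \<in> prim_roots k" "z' \<in> prim_roots k" "evi P z = 0"
  shows "evi P z' = 0"
proof -
  have step: "\<forall>z\<in>prim_roots k. evi P z = 0 \<longrightarrow> coprime j k \<longrightarrow> j > 0 \<longrightarrow> evi P (z ^ j) = 0" for j
  proof (induction j rule: prime_divisors_induct)
    case (factor p x)
    show ?case
    proof (intro ballI impI)
      fix z assume z: "z \<in> prim_roots k" "evi P z = 0" "coprime (p * x) k" "p * x > 0"
      have "\<not> p dvd k"
        using z(3) factor(1) by (metis coprime_mult_left_iff coprime_absorb_left not_prime_unit)
      then have "evi P (z ^ p) = 0"
        using frobenius_root[of z k p P] z assms(1) factor(1) by (auto simp: prim_roots_def)
      moreover have "z ^ p \<in> prim_roots k"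
        using prim_roots_power[OF z(1) assms(1)] z(3) by simp
      ultimately show "evi P (z ^ (p * x)) = 0"
        using factor(2) z by (simp add: power_mult)
    qed
  qed auto
  obtain j where j: "z' = z ^ j"
    using prim_roots_generate[OF assms(2,1), of z'] assms(3) by (auto simp: prim_roots_def)
  have co: "coprime j k" using assms j prim_roots_power by blast
  show ?thesis
  proof (cases "j = 0")
    case True
    then have "k = 1" using co by simp
    then show ?thesis using assms by (auto simp: prim_roots_def)
  next
    case False
    then show ?thesis using step co j assms by auto
  qed
qed

section \<open>Cyclotomic polynomials\<close>

lemma moebius_mu_mult_prime:
  assumes "prime q" "\<not> q dvd m"
  shows "moebius_mu (m * q) = - moebius_mu m"
proof -
  have m0: "m \<noteq> 0" and q0: "q \<noteq> 0" using assms by (metis dvd_0_right, auto)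
  have co: "coprime m q" using assms by (metis prime_imp_coprime coprime_commute)
  have "prime_factors (m * q) = insert q (prime_factors m)"
    using m0 q0 assms(1) by (auto simp: prime_factors_product prime_prime_factors)
  moreover have "q \<notin> prime_factors m" using assms by auto
  ultimately have "card (prime_factors (m * q)) = Suc (card (prime_factors m))" by simp
  moreover have "squarefree (m * q) \<longleftrightarrow> squarefree m"
    using co assms(1) squarefree_mult_coprime[OF co] squarefree_prime[of q] squarefree_multD(1)[of m q] by auto
  ultimately show ?thesis using m0 q0 by (simp add: moebius_mu_def)
qed

text \<open>The identity that the Moebius function sums to 0 over the divisors of n > 1, as a count
  of signs because \<open>moebius_prod\<close> separates them. The bijection inserts or removes a
  fixed prime q dividing n, which flips the sign on squarefree divisors.\<close>

lemma card_moebius: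
  assumes "n > 0"
  shows "card {m. m dvd n \<and> moebius_mu m = 1} = card {m. m dvd n \<and> moebius_mu m = -1} + (if n = 1 then 1 else 0)"
proof (cases "n = 1")
  case True
  have "moebius_mu 1 = 1" by (simp add: moebius_mu_def)
  then have "{m. m dvd n \<and> moebius_mu m = 1} = {1}" "{m. m dvd n \<and> moebius_mu m = -1} = {}"
    using True by auto
  then show ?thesis using True by simp
next
  case False
  then obtain q where q: "prime q" "q dvd n" using prime_factor_nat by blast
  define t where "t m = (if q dvd m then m div q else m * q)" for m
  have t: "t m dvd n \<and> moebius_mu (t m) = - moebius_mu m \<and> t (t m) = m"
    if m: "m dvd n" "moebius_mu m \<noteq> 0" for m
  proof (cases "q dvd m")
    case True
    then obtain l where l: "m = l * q" by (metis dvdE mult.commute)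
    have "squarefree m" using m(2) by (auto simp: moebius_mu_def split: if_splits)
    have nql: "\<not> q dvd l"
    proof
      assume "q dvd l"
      then have "q ^ 2 dvd m" unfolding l by (simp add: power2_eq_square mult_dvd_mono)
      with \<open>squarefree m\<close> have "is_unit q" by (auto simp: squarefree_def)
      then show False using q(1) by simp
    qed
    have "t m = l" using True l q(1) by (auto simp: t_def)
    then show ?thesis using nql l m(1) moebius_mu_mult_prime[OF q(1) nql] by (auto simp: t_def dest: dvd_mult_left)
  next
    case False
    then have "coprime m q" using q(1) by (metis prime_imp_coprime coprime_commute)
    then have "m * q dvd n" using m(1) q(2) by (simp add: divides_mult)
    then show ?thesis using False moebius_mu_mult_prime[OF q(1) False] q(1) by (auto simp: t_def)
  qed
  have "bij_betw t {m. m dvd n \<and> moebius_mu m = 1} {m. m dvd n \<and> moebius_mu m = -1}"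
    by (rule bij_betw_byWitness[where f' = t]) (use t in auto)
  then show ?thesis using False by (auto dest: bij_betw_same_card)
qed

text \<open>The two counts are the exponents of the cyclotomic factor of index e in the numerator
  and the denominator of the Moebius quotient. The substitution m = k div j reduces them to the
  divisors of k div e.\<close>

lemma card_moebius_multiples:
  assumes "k > 0" "e dvd k"
  shows "card {j. j dvd k \<and> moebius_mu (k div j) = 1 \<and> e dvd j} =
    card {j. j dvd k \<and> moebius_mu (k div j) = -1 \<and> e dvd j} + (if e = k then 1 else 0)"
proof -
  have e: "e > 0" using assms by (auto intro: Nat.gr0I)
  have 1: "card {j. j dvd k \<and> moebius_mu (k div j) = c \<and> e dvd j} = card {m. m dvd k div e \<and> moebius_mu m = c}" for c
  proof (rule bij_betw_same_card[of "\<lambda>j. k div j"], rule bij_betw_byWitness[where f' = "\<lambda>m. k div m"])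
    have j1: "k div j dvd k div e" "k div (k div j) = j" if "j dvd k" "e dvd j" for j
      using that assms(1) by (auto elim!: dvdE)
    have j2: "m dvd k" "k div m dvd k" "e dvd k div m" "k div (k div m) = m" if "m dvd k div e" for m
    proof -
      obtain l where "k = e * l" using assms(2) by auto
      moreover from this have "m dvd l" using that e by simp
      then obtain l' where "l = m * l'" by (elim dvdE)
      ultimately show "m dvd k" "k div m dvd k" "e dvd k div m" "k div (k div m) = m" using assms(1) by auto
    qed
    show "\<forall>a\<in>{j. j dvd k \<and> moebius_mu (k div j) = c \<and> e dvd j}. k div (k div a) = a" using j1 by auto
    show "\<forall>a'\<in>{m. m dvd k div e \<and> moebius_mu m = c}. k div (k div a') = a'" using j2 by auto
    show "(div) k ` {j. j dvd k \<and> moebius_mu (k div j) = c \<and> e dvd j} \<subseteq> {m. m dvd k div e \<and> moebius_mu m = c}"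
      using j1 by auto
    show "(div) k ` {m. m dvd k div e \<and> moebius_mu m = c} \<subseteq> {j. j dvd k \<and> moebius_mu (k div j) = c \<and> e dvd j}"
      using j2 by auto
  qed
  have "k div e > 0" using assms e by (auto elim!: dvdE)
  moreover have "k div e = 1 \<longleftrightarrow> e = k" using assms e by (auto elim!: dvdE)
  ultimately show ?thesis unfolding 1 using card_moebius[of "k div e"] by simp
qed

definition cyclo_c :: "nat \<Rightarrow> complex poly" where
  "cyclo_c k = (\<Prod>z\<in>prim_roots k. [:-z, 1:])"

lemma monom_minus_1_eq_prod_roots:
  assumes "d > 0"
  shows "monom 1 d - 1 = (\<Prod>z | z ^ d = 1. [:-z, 1 :: complex:])"
proof -
  define X :: "complex poly" where "X = monom 1 d - 1"
  have "degree X = degree (monom (1::complex) d)" unfolding X_def diff_conv_add_uminus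
    by (rule degree_add_eq_left) (use assms in \<open>simp add: degree_monom_eq\<close>)
  then have "degree X = d" by (simp add: degree_monom_eq)
  then have lc: "lead_coeff X = 1" using assms by (simp add: X_def)
  have "rsquarefree X"
    unfolding rsquarefree_roots X_def using assms
    by (auto simp: poly_monom pderiv_diff pderiv_monom zero_power)
  then have "X = smult (lead_coeff X) (\<Prod>z | poly X z = 0. [:-z, 1:])"
    by (rule complex_poly_decompose_rsquarefree[symmetric])
  then show ?thesis using lc by (simp add: X_def poly_monom)
qed

lemma monom_minus_1_eq_prod_cyclo_c:
  assumes "d > 0"
  shows "monom 1 d - 1 = (\<Prod>e | e dvd d. cyclo_c e)"
proof -
  have roots: "{z::complex. z ^ d = 1} = (\<Union>e\<in>{e. e dvd d}. prim_roots e)"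
  proof (intro equalityI subsetI)
    fix z :: complex assume "z \<in> {z. z ^ d = 1}"
    then show "z \<in> (\<Union>e\<in>{e. e dvd d}. prim_roots e)" using prim_roots_of_root[of z d] assms by auto
  next
    fix z assume "z \<in> (\<Union>e\<in>{e. e dvd d}. prim_roots e)"
    then obtain e where e: "e dvd d" "z \<in> prim_roots e" by auto
    moreover have "e > 0" using e assms by (auto intro: Nat.gr0I)
    ultimately show "z \<in> {z. z ^ d = 1}" using prim_roots_power_eq_1_iff[of z e d] by auto
  qed
  have pos: "e > 0" if "e dvd d" for e using that assms by (auto intro: Nat.gr0I)
  have "(\<Prod>z | z ^ d = 1. [:-z, 1 :: complex:]) = (\<Prod>e | e dvd d. \<Prod>z\<in>prim_roots e. [:-z, 1:])"
    unfolding roots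
  proof (rule prod.UNION_disjoint)
    show "\<forall>i\<in>{e. e dvd d}. \<forall>j\<in>{e. e dvd d}. i \<noteq> j \<longrightarrow> prim_roots i \<inter> prim_roots j = {}"
    proof (intro ballI impI)
      fix i j assume ij: "i \<in> {e. e dvd d}" "j \<in> {e. e dvd d}" "i \<noteq> j"
      show "prim_roots i \<inter> prim_roots j = {}"
      proof (rule ccontr)
        assume "prim_roots i \<inter> prim_roots j \<noteq> {}"
        then obtain z where z: "z \<in> prim_roots i" "z \<in> prim_roots j" by auto
        have "i dvd j" "j dvd i"
          using prim_roots_power_eq_1_iff[OF z(1) pos, of j] prim_roots_power_eq_1_iff[OF z(2) pos, of i] z ij
          by (auto simp: prim_roots_def)
        then show False using ij(3) by (simp add: dvd_antisym)
      qed
    qed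
  qed (use assms pos finite_prim_roots in auto)
  then show ?thesis using monom_minus_1_eq_prod_roots[OF assms] by (simp add: cyclo_c_def)
qed

text \<open>Each X^j - 1 is split into cyclotomic factors and the two products are interchanged. All
  exponents then agree on both sides except the one of index k.\<close>

lemma moebius_numerator_eq:
  assumes "k > 0"
  shows "(\<Prod>j | j dvd k \<and> moebius_mu (k div j) = 1. monom 1 j - 1) =
    cyclo_c k * (\<Prod>j | j dvd k \<and> moebius_mu (k div j) = -1. monom 1 j - 1)"
proof -
  have fin: "finite {e. e dvd k}" using assms by simp
  have pos: "e > 0" if "e dvd k" for e using that assms by (auto intro: Nat.gr0I)
  have P: "(\<Prod>j | j dvd k \<and> moebius_mu (k div j) = c. monom 1 j - 1) =
     (\<Prod>e | e dvd k. cyclo_c e ^ card {j. j dvd k \<and> moebius_mu (k div j) = c \<and> e dvd j})" for c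
  proof -
    have fin': "finite {j. j dvd k \<and> moebius_mu (k div j) = c}" by (rule finite_subset[OF _ fin]) auto
    have "(\<Prod>j | j dvd k \<and> moebius_mu (k div j) = c. monom 1 j - 1) =
      (\<Prod>j | j dvd k \<and> moebius_mu (k div j) = c. \<Prod>e | e dvd k. if e dvd j then cyclo_c e else 1)"
    proof (rule prod.cong[OF refl])
      fix j assume j: "j \<in> {j. j dvd k \<and> moebius_mu (k div j) = c}"
      have "{e. e dvd j} = {e. e dvd k} \<inter> {e. e dvd j}" using j by (auto intro: dvd_trans)
      then show "monom 1 j - 1 = (\<Prod>e | e dvd k. if e dvd j then cyclo_c e else 1)"
        using monom_minus_1_eq_prod_cyclo_c[of j] j pos fin by (simp add: prod.If_cases)
    qed
    also have "\<dots> = (\<Prod>e | e dvd k. \<Prod>j | j dvd k \<and> moebius_mu (k div j) = c. if e dvd j then cyclo_c e else 1)"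
      by (rule prod.swap)
    also have "\<dots> = (\<Prod>e | e dvd k. cyclo_c e ^ card {j. j dvd k \<and> moebius_mu (k div j) = c \<and> e dvd j})"
    proof (rule prod.cong[OF refl])
      fix e
      have "{j. j dvd k \<and> moebius_mu (k div j) = c} \<inter> {j. e dvd j} = {j. j dvd k \<and> moebius_mu (k div j) = c \<and> e dvd j}" by auto
      then show "(\<Prod>j | j dvd k \<and> moebius_mu (k div j) = c. if e dvd j then cyclo_c e else 1) =
        cyclo_c e ^ card {j. j dvd k \<and> moebius_mu (k div j) = c \<and> e dvd j}"
        using fin' by (simp add: prod.If_cases)
    qed
    finally show ?thesis .
  qed
  have "(\<Prod>e | e dvd k. cyclo_c e ^ card {j. j dvd k \<and> moebius_mu (k div j) = 1 \<and> e dvd j}) =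
    (\<Prod>e | e dvd k. (if e = k then cyclo_c k else 1) * cyclo_c e ^ card {j. j dvd k \<and> moebius_mu (k div j) = -1 \<and> e dvd j})"
    using card_moebius_multiples[OF assms] by (intro prod.cong) auto
  also have "\<dots> = cyclo_c k * (\<Prod>e | e dvd k. cyclo_c e ^ card {j. j dvd k \<and> moebius_mu (k div j) = -1 \<and> e dvd j})"
    using fin by (simp add: prod.distrib)
  finally show ?thesis unfolding P .
qed

lemma lead_coeff_monom_minus_1:
  assumes "j > 0" shows "lead_coeff (monom 1 j - 1 :: 'a :: idom poly) = 1"
proof -
  have "degree (monom 1 j - 1 :: 'a poly) = degree (monom (1::'a) j)" unfolding diff_conv_add_uminus
    by (rule degree_add_eq_left) (use assms in \<open>simp add: degree_monom_eq\<close>)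
  then show ?thesis using assms by (simp add: degree_monom_eq)
qed

text \<open>The \<open>div\<close> in the definition is exact: the denominator is monic and the
  quotient exists over the complex numbers.\<close>

theorem map_poly_cyclo:
  assumes "k > 0"
  shows "map_poly of_int (cyclo k) = cyclo_c k"
proof -
  let ?N = "\<Prod>j | j dvd k \<and> moebius_mu (k div j) = 1. monom 1 j - 1 :: int poly"
  let ?D = "\<Prod>j | j dvd k \<and> moebius_mu (k div j) = -1. monom 1 j - 1 :: int poly"
  have pos: "e > 0" if "e dvd k" for e using that assms by (auto intro: Nat.gr0I)
  have lc: "lead_coeff ?D = 1"
    unfolding lead_coeff_prod by (rule prod.neutral) (use lead_coeff_monom_minus_1[where 'a = int] pos in auto)
  have "map_poly of_int ?N = cyclo_c k * map_poly of_int ?D"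
    using moebius_numerator_eq[OF assms] by (simp add: hom_distribs)
  from of_int_hom.dvd_of_map_poly_dvd[OF lc this]
  obtain q where q: "?N = q * ?D" "map_poly of_int q = cyclo_c k" by auto
  have "?D \<noteq> 0" using lc by auto
  then have "cyclo k = q" unfolding cyclo_def moebius_prod_def q(1) by simp
  with q(2) show ?thesis by simp
qed

lemma lead_coeff_cyclo_c: "lead_coeff (cyclo_c k) = 1"
  unfolding cyclo_c_def lead_coeff_prod by (rule prod.neutral) auto

lemma degree_cyclo_c: "degree (cyclo_c k) = card (prim_roots k)"
  unfolding cyclo_c_def by (subst degree_prod_eq_sum_degree) auto

lemma poly_cyclo_c: "poly (cyclo_c k) x = (\<Prod>z\<in>prim_roots k. x - z)"
  unfolding cyclo_c_def by (simp add: poly_prod)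

lemma lead_coeff_cyclo: "k > 0 \<Longrightarrow> lead_coeff (cyclo k) = 1"
  using lead_coeff_cyclo_c[of k] by (simp flip: map_poly_cyclo)

lemma degree_cyclo: "k > 0 \<Longrightarrow> degree (cyclo k) = card (prim_roots k)"
  using degree_cyclo_c[of k] by (simp flip: map_poly_cyclo)

section \<open>Almost integral elements of cyclotomic fields\<close>

lemma clear_denominators:
  fixes P :: "rat poly"
  shows "\<exists>(c::nat) Q. c > 0 \<and> smult (of_nat c) P = map_poly of_int Q"
proof (induction P)
  case 0
  show ?case by (intro exI[of _ 1] exI[of _ 0]) auto
next
  case (pCons a P)
  then obtain c Q where cQ: "c > 0" "smult (of_nat c) P = map_poly of_int Q" by blast
  obtain m n where mn: "a = of_int m / of_int n" "n > 0" by (metis quotient_of_div quotient_of_denom_pos surj_pair)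
  have "smult (of_nat (nat n * c)) (pCons a P) = map_poly of_int (pCons (m * int c) (smult n Q))"
  proof -
    have "smult (of_nat (nat n * c)) P = smult (of_int n) (map_poly of_int Q)"
      using mn(2) by (simp flip: cQ(2))
    then show ?thesis using mn by (simp add: hom_distribs field_simps)
  qed
  then show ?case using mn cQ by (intro exI[of _ "nat n * c"]) (auto intro!: exI)
qed

abbreviation evr :: "rat poly \<Rightarrow> complex \<Rightarrow> complex" where
  "evr P z \<equiv> poly (map_poly of_rat P) z"

lemma evr_simps [simp]:
  "evr (P + Q) z = evr P z + evr Q z"
  "evr (P - Q) z = evr P z - evr Q z"
  "evr (P * Q) z = evr P z * evr Q z"
  "evr (- P) z = - evr P z"
  "evr (P ^ n) z = evr P z ^ n"
  "evr [:c:] z = of_rat c"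
  "evr (monom c n) z = of_rat c * z ^ n"
  "evr 1 z = 1"
  "evr (smult c P) z = of_rat c * evr P z"
  "evr (pcompose P Q) z = evr P (evr Q z)"
proof -
  interpret mp: map_poly_inj_idom_hom "of_rat :: rat \<Rightarrow> complex" ..
  show "evr (P + Q) z = evr P z + evr Q z"
    "evr (P - Q) z = evr P z - evr Q z"
    "evr (P * Q) z = evr P z * evr Q z"
    "evr (- P) z = - evr P z"
    "evr (P ^ n) z = evr P z ^ n"
    "evr [:c:] z = of_rat c"
    "evr (monom c n) z = of_rat c * z ^ n"
    "evr 1 z = 1"
    "evr (smult c P) z = of_rat c * evr P z"
    "evr (pcompose P Q) z = evr P (evr Q z)"
    by (simp_all add: hom_distribs poly_monom of_rat_hom.map_poly_pcompose poly_pcompose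
      mp.hom_minus mp.hom_mult mp.hom_uminus mp.hom_power)
qed

lemma evr_of_int [simp]: "evr (map_poly of_int P) z = evi P z"
  by (simp add: map_poly_map_poly o_def)

lemma evi_cnj: "evi P (cnj z) = cnj (evi P z)"
  by (induction P) (auto simp: hom_distribs)

lemma evr_cnj: "evr P (cnj z) = cnj (evr P z)"
proof (induction P)
  case (pCons a P)
  obtain m n where "a = of_int m / of_int n" by (metis quotient_of_div surj_pair)
  then have "cnj (of_rat a) = of_rat a" by (simp add: of_rat_divide)
  with pCons show ?case by (auto simp: hom_distribs)
qed auto

theorem conjugate_root_rat:
  assumes "k > 0" "z \<in> prim_roots k" "z' \<in> prim_roots k" "evr P z = 0"
  shows "evr P z' = 0"
proof -
  obtain c :: nat and Q where cQ: "c > 0" "smult (of_nat c) P = map_poly of_int Q"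
    using clear_denominators by blast
  have ev: "of_nat c * evr P x = evi Q x" for x
    by (metis cQ(2) evr_of_int evr_simps(9) of_rat_of_nat_eq)
  then have "evi Q z' = 0"
    using conjugate_root[OF assms(1-3)] assms(4) by (metis mult_zero_right)
  then show ?thesis using ev[of z'] cQ(1) by simp
qed

section \<open>The order Z[z] and its almost integral elements\<close>

definition Zring :: "complex \<Rightarrow> complex set" where
  "Zring z = range (\<lambda>P. evi P z)"

lemma Zring_evi [simp, intro]: "evi P z \<in> Zring z" by (auto simp: Zring_def)

lemma ZringE:
  assumes "a \<in> Zring z"
  obtains P where "a = evi P z"
  using assms by (auto simp: Zring_def)

lemma Zring_of_int [simp, intro]: "of_int c \<in> Zring z"
  using Zring_evi[of "[:c:]" z] by simp

lemma Zring_of_nat [simp, intro]: "of_nat c \<in> Zring z"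
  using Zring_of_int[of "int c" z] by simp

lemma Zring_0_1 [simp, intro]: "0 \<in> Zring z" "1 \<in> Zring z"
  using Zring_of_int[of 0 z] Zring_of_int[of 1 z] by simp_all

lemma Zring_self [simp, intro]: "z \<in> Zring z"
  using Zring_evi[of "[:0, 1:]" z] by (simp add: hom_distribs)

lemma Zring_add [intro]: "a \<in> Zring z \<Longrightarrow> b \<in> Zring z \<Longrightarrow> a + b \<in> Zring z"
  by (elim ZringE) (metis Zring_evi evi_simps(1))

lemma Zring_diff [intro]: "a \<in> Zring z \<Longrightarrow> b \<in> Zring z \<Longrightarrow> a - b \<in> Zring z"
  by (elim ZringE) (metis Zring_evi evi_simps(2))

lemma Zring_mult [intro]: "a \<in> Zring z \<Longrightarrow> b \<in> Zring z \<Longrightarrow> a * b \<in> Zring z"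
  by (elim ZringE) (metis Zring_evi evi_simps(3))

lemma Zring_power [intro]: "a \<in> Zring z \<Longrightarrow> a ^ n \<in> Zring z"
  by (induction n) auto

lemma Zring_uminus [intro]: "a \<in> Zring z \<Longrightarrow> - a \<in> Zring z"
  using Zring_diff[of 0 z a] by simp

lemma Zring_sum [intro]: "(\<And>i. i \<in> I \<Longrightarrow> f i \<in> Zring z) \<Longrightarrow> sum f I \<in> Zring z"
  by (induction I rule: infinite_finite_induct) auto

lemma Zring_prod [intro]: "(\<And>i. i \<in> I \<Longrightarrow> f i \<in> Zring z) \<Longrightarrow> prod f I \<in> Zring z"
  by (induction I rule: infinite_finite_induct) auto

lemmas Zring_intros = Zring_evi Zring_0_1 Zring_self Zring_of_int Zring_of_nat Zring_add Zring_diff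
  Zring_mult Zring_power Zring_uminus Zring_sum

lemma Zring_trans: "w \<in> Zring z \<Longrightarrow> a \<in> Zring w \<Longrightarrow> a \<in> Zring z"
  by (elim ZringE) (metis Zring_evi evi_pcompose)

text \<open>For \<^term>\<open>z\<close> a root of unity this is the ring of integers of the cyclotomic field:
  almost integral elements replace integral ones, which makes the ring axioms immediate.\<close>

definition Oring :: "complex \<Rightarrow> complex set" where
  "Oring z = {w. \<exists>D::nat. D > 0 \<and> (\<forall>n. of_nat D * w ^ n \<in> Zring z)}"

lemma OringE:
  assumes "w \<in> Oring z"
  obtains D :: nat where "D > 0" "\<And>n. of_nat D * w ^ n \<in> Zring z"
  using assms unfolding Oring_def by blast

lemma OringI: "(D::nat) > 0 \<Longrightarrow> (\<And>n. of_nat D * w ^ n \<in> Zring z) \<Longrightarrow> w \<in> Oring z"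
  unfolding Oring_def by blast

lemma Zring_subset_Oring: "w \<in> Zring z \<Longrightarrow> w \<in> Oring z"
  by (rule OringI[of 1]) auto

lemma Oring_mult:
  assumes "a \<in> Oring z" "b \<in> Oring z"
  shows "a * b \<in> Oring z"
proof -
  obtain D where D: "D > 0" "\<And>n. of_nat D * a ^ n \<in> Zring z" using OringE[OF assms(1)] by metis
  obtain E where E: "E > 0" "\<And>n. of_nat E * b ^ n \<in> Zring z" using OringE[OF assms(2)] by metis
  show ?thesis
  proof (rule OringI[of "D * E"])
    fix n
    have "of_nat (D * E) * (a * b) ^ n = (of_nat D * a ^ n) * (of_nat E * b ^ n)"
      by (simp add: power_mult_distrib)
    then show "of_nat (D * E) * (a * b) ^ n \<in> Zring z" using D E by (metis Zring_mult)
  qed (use D E in auto)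
qed

lemma Oring_Zring_mult: "a \<in> Zring z \<Longrightarrow> b \<in> Oring z \<Longrightarrow> a * b \<in> Oring z"
  by (rule Oring_mult[OF Zring_subset_Oring])

lemma Oring_add:
  assumes "a \<in> Oring z" "b \<in> Oring z"
  shows "a + b \<in> Oring z"
proof -
  obtain D where D: "D > 0" "\<And>n. of_nat D * a ^ n \<in> Zring z" using OringE[OF assms(1)] by metis
  obtain E where E: "E > 0" "\<And>n. of_nat E * b ^ n \<in> Zring z" using OringE[OF assms(2)] by metis
  show ?thesis
  proof (rule OringI[of "D * E"])
    fix n
    have "of_nat (D * E) * (a + b) ^ n =
      (\<Sum>i\<le>n. of_nat (n choose i) * ((of_nat D * a ^ i) * (of_nat E * b ^ (n - i))))"
      by (simp add: binomial_ring sum_distrib_left mult_ac)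
    moreover have "\<dots> \<in> Zring z" using D E by (intro Zring_sum Zring_mult[OF Zring_of_nat] Zring_mult[OF D(2) E(2)])
    ultimately show "of_nat (D * E) * (a + b) ^ n \<in> Zring z" by simp
  qed (use D E in auto)
qed

lemma Oring_uminus: "a \<in> Oring z \<Longrightarrow> - a \<in> Oring z"
  using Oring_mult[OF Zring_subset_Oring[OF Zring_of_int[of "-1"]], of a z] by simp

lemma Oring_diff: "a \<in> Oring z \<Longrightarrow> b \<in> Oring z \<Longrightarrow> a - b \<in> Oring z"
  using Oring_add[OF _ Oring_uminus, of a z b] by simp

lemma Oring_power: "a \<in> Oring z \<Longrightarrow> a ^ n \<in> Oring z"
  by (induction n) (auto intro: Oring_mult Zring_subset_Oring)

lemma proots_cyclo_c:
  assumes "k > 0"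
  shows "proots (cyclo_c k) = mset_set (prim_roots k)"
proof -
  have "proots (cyclo_c k) = (\<Sum>z\<in>prim_roots k. proots [:-z, 1:])"
    unfolding cyclo_c_def by (rule proots_prod) auto
  also have "\<dots> = (\<Sum>z\<in>prim_roots k. {#z#})"
    by (intro sum.cong refl) (subst proots_linear_factor, simp)
  also have "\<dots> = mset_set (prim_roots k)"
    using finite_prim_roots[OF assms] by (induction rule: finite_induct) auto
  finally show ?thesis .
qed

text \<open>This product is the norm of P(z), and it equals the resultant of two integer
  polynomials.\<close>

lemma prod_conjugates_Ints:
  assumes "k > 0"
  shows "(\<Prod>z\<in>prim_roots k. evi P z) \<in> \<int>"
proof -
  have "of_int (resultant (cyclo k) P) = resultant (cyclo_c k) (map_poly of_int P)"
    using of_int_hom.resultant_hom[of "cyclo k" P] map_poly_cyclo[OF assms] by metis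
  also have "\<dots> = (\<Prod>z\<in>#proots (cyclo_c k). evi P z)"
    using lead_coeff_cyclo_c[of k] by (subst resultant_eq_prod_proots) auto
  also note proots_cyclo_c[OF assms]
  finally show ?thesis by (simp add: prod_unfold_prod_mset flip: Ints_of_int) (metis Ints_of_int)
qed

text \<open>Norm argument: the norm of $D w^n$ is an integer, and it tends to zero with $n$ when all conjugates
  of $w$ have absolute value below one.\<close>

theorem Oring_eq_0:
  assumes k: "k > 0" and z: "z \<in> prim_roots k" and w: "w \<in> Oring z"
    and PQ: "w * evr Q z = evr P z"
    and less: "\<And>z'. z' \<in> prim_roots k \<Longrightarrow> norm (evr P z') < norm (evr Q z')"
  shows "w = 0"
proof -
  obtain D where D: "D > 0" "\<And>n. of_nat D * w ^ n \<in> Zring z" using OringE[OF w] by metis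
  have "\<forall>n. \<exists>R. of_nat D * w ^ n = evi R z" using D(2) unfolding Zring_def by blast
  then obtain R where R: "\<And>n. of_nat D * w ^ n = evi (R n) z" by metis
  \<comment> \<open>\<open>PQ\<close> writes w as the fraction P/Q at z. Conjugacy carries the
    formula for D w^n over to every primitive root, which gives the conjugates of w a
    meaning.\<close>
  have R': "evi (R n) z' * evr Q z' ^ n = of_nat D * evr P z' ^ n" if "z' \<in> prim_roots k" for z' n
  proof -
    have "evr (map_poly of_int (R n) * Q ^ n - smult (of_nat D) (P ^ n)) z = 0"
      by (simp add: R[symmetric] PQ[symmetric] power_mult_distrib)
    from conjugate_root_rat[OF k z that this] show ?thesis by simp
  qed
  define M where "M = (\<Prod>z'\<in>prim_roots k. norm (evr P z') / norm (evr Q z'))"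
  define S where "S = prim_roots k"
  have fin: "finite S" and zS: "z \<in> S" using finite_prim_roots[OF k] z by (auto simp: S_def)
  have Qpos: "norm (evr Q z') > 0" if "z' \<in> S" for z'
    using less[of z'] that norm_ge_zero[of "evr P z'"] unfolding S_def by linarith
  have M1: "M < 1" "M \<ge> 0"
  proof -
    \<comment> \<open>Splitting off the factor at z keeps the inequality strict: the remaining
      factors are at most 1, and this one is below 1.\<close>
    let ?f = "\<lambda>z'. norm (evr P z') / norm (evr Q z')"
    have "M = ?f z * prod ?f (S - {z})" unfolding M_def S_def[symmetric] by (rule prod.remove[OF fin zS])
    also have "\<dots> \<le> ?f z"
      by (rule mult_left_le[OF prod_le_1]) (use Qpos less in \<open>auto simp: S_def less_imp_le\<close>)
    also have "\<dots> < 1" using less[OF z] Qpos[OF zS] by simp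
    finally show "M < 1" .
    show "M \<ge> 0" unfolding M_def by (intro prod_nonneg) auto
  qed
  have N: "norm (\<Prod>z'\<in>S. evi (R n) z') = real D ^ card S * M ^ n" for n
  proof -
    have "norm (\<Prod>z'\<in>S. evi (R n) z') = (\<Prod>z'\<in>S. norm (evi (R n) z'))" by (simp add: prod_norm)
    also have "\<dots> = (\<Prod>z'\<in>S. real D * (norm (evr P z') / norm (evr Q z')) ^ n)"
    proof (rule prod.cong[OF refl])
      fix z' assume "z' \<in> S"
      then have "norm (evi (R n) z' * evr Q z' ^ n) = norm (of_nat D * evr P z' ^ n)"
        using R'[of z' n] by (simp add: S_def)
      then show "norm (evi (R n) z') = real D * (norm (evr P z') / norm (evr Q z')) ^ n"
        using Qpos[OF \<open>z' \<in> S\<close>] by (simp add: norm_mult norm_power field_simps)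
    qed
    also have "\<dots> = real D ^ card S * M ^ n"
      by (simp add: prod.distrib M_def S_def prod_power_distrib)
    finally show ?thesis .
  qed
  have "(\<lambda>n. real D ^ card S * M ^ n) \<longlonglongrightarrow> real D ^ card S * 0"
    by (intro tendsto_intros LIMSEQ_realpow_zero M1)
  then have "eventually (\<lambda>n. real D ^ card S * M ^ n < 1) sequentially"
    by (rule order_tendstoD) simp
  then obtain n where n: "real D ^ card S * M ^ n < 1" by (meson eventually_happens' sequentially_bot)
  have "(\<Prod>z'\<in>S. evi (R n) z') = 0"
    using n N[of n] prod_conjugates_Ints[OF k, of "R n"] by (auto simp: S_def elim!: Ints_cases)
  then obtain z' where "z' \<in> prim_roots k" "evi (R n) z' = 0"
    using fin by (auto simp: S_def prod_zero_iff)
  then have "evi (R n) z = 0" using conjugate_root[OF k _ z] by blast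
  then have "of_nat D * w ^ n = 0" using R[of n] by simp
  then show ?thesis using D(1) by simp
qed

section \<open>Differences of complex conjugates\<close>

text \<open>If p did not divide b, it would be coprime to b^e. Both p and b^e are multiples of p in
  \<open>Oring z\<close>, so Bezout puts 1/p there. But 1/p is rational of absolute value below 1,
  so the norm argument would make it zero.\<close>

lemma Oring_dvd_imp_int_dvd:
  assumes k: "k > 0" and z: "z \<in> prim_roots k" and p: "prime p"
    and e: "of_nat p = \<pi> ^ e * U" "U \<in> Zring z" "inverse U \<in> Zring z" 
    and b: "of_int b = \<pi> * w" "w \<in> Oring z"
  shows "int p dvd b"
proof (rule ccontr)
  assume "\<not> int p dvd b"
  then have "coprime (int p) (b ^ e)"
    using p by (simp add: prime_imp_coprime)
  then obtain x y where xy: "x * int p + y * b ^ e = 1"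
    using bezout_int[of "int p" "b ^ e"] by auto
  have p0: "(of_nat p :: complex) \<noteq> 0" using p by auto
  then have U0: "U \<noteq> 0" using e(1) by auto
  have "(of_int (b ^ e) :: complex) = of_nat p * (inverse U * w ^ e)"
    using e(1) U0 b(1) by (simp add: power_mult_distrib)
  moreover have "(of_int (x * int p + y * b ^ e) :: complex) = 1" unfolding xy by simp
  ultimately have "of_nat p * (of_int x + of_int y * (inverse U * w ^ e)) = 1"
    by (simp add: algebra_simps)
  then have eq: "1 / of_nat p = of_int x + of_int y * (inverse U * w ^ e)"
    using p0 by (simp add: field_simps)
  have "1 / of_nat p \<in> Oring z"
    unfolding eq by (intro Oring_add Oring_Zring_mult[OF Zring_of_int] Oring_Zring_mult[OF e(3)] Oring_power
      Zring_subset_Oring[OF Zring_of_int] b(2))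
  then have "(1 / of_nat p :: complex) = 0"
  proof (rule Oring_eq_0[OF k z, of _ 1 "[:1 / of_nat p:]"])
    show "1 / of_nat p * evr 1 z = evr [:1 / rat_of_nat p:] z" by (simp add: of_rat_divide)
    show "norm (evr [:1 / rat_of_nat p:] z') < norm (evr 1 z')" for z'
      using prime_gt_1_nat[OF p] by (simp add: of_rat_divide norm_divide)
  qed
  then show False using p0 by simp
qed

text \<open>Modulo 1 - x every element of Z[x] is congruent to an integer, namely P(1). This
  supplies the digits of expansions in powers of 1 - z and the triviality of conjugation modulo 1 -
  z.\<close>

lemma evi_eq_at_1:
  obtains Q where "evi P x = of_int (poly P 1) + (1 - x) * evi Q x"
proof -
  have "[:-1, 1:] dvd P - [:poly P 1:]" by (subst poly_eq_0_iff_dvd[symmetric]) simp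
  then obtain Q where "P - [:poly P 1:] = [:-1, 1:] * Q" by auto
  then have "evi (P - [:poly P 1:]) x = evi ([:-1, 1:] * Q) x" by simp
  then have "evi P x = of_int (poly P 1) + (1 - x) * evi (- Q) x"
    by (simp add: hom_distribs algebra_simps)
  then show ?thesis by (rule that)
qed

text \<open>Local maximality of \<^term>\<open>Zring z\<close> at $p$: expand $p v$ in powers of $1 - z$ and show digit by digit,
  up to the power of $1 - z$ that is associated to $p$, that the coefficients are divisible by $p$.\<close>

lemma Zring_of_prime_mult:
  assumes k: "k > 0" and z: "z \<in> prim_roots k" and p: "prime p"
    and e: "of_nat p = (1 - z) ^ e * U" "U \<in> Zring z" "inverse U \<in> Zring z"
    and v: "of_nat p * v \<in> Zring z" "v \<in> Oring z"
  shows "v \<in> Zring z"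
proof -
  have p0: "(of_nat p :: complex) \<noteq> 0" using p by auto
  then have U0: "U \<noteq> 0" and e0: "e > 0 \<Longrightarrow> 1 - z \<noteq> 0" using e(1) by auto
  have "j \<le> e \<longrightarrow> (\<exists>A\<in>Zring z. \<exists>B\<in>Zring z. of_nat p * v = of_nat p * A + (1 - z) ^ j * B)" for j
  proof (induction j)
    case 0
    show ?case by (intro impI, rule bexI[of _ 0], rule bexI[of _ "of_nat p * v"]) (use v in auto)
  next
    case (Suc j)
    show ?case
    proof
      assume j: "Suc j \<le> e"
      then obtain A B where AB: "A \<in> Zring z" "B \<in> Zring z" "of_nat p * v = of_nat p * A + (1 - z) ^ j * B"
        using Suc by auto
      \<comment> \<open>Since j < e, after cancelling (1 - z)^j the prime p still contributes a
        factor 1 - z. So the next digit is divisible by 1 - z, and being an integer it is divisible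
        by p.\<close>
      obtain i where i: "e = j + Suc i" using j by (metis add_Suc_shift le_Suc_ex add.commute)
      have "(1 - z) ^ j * B = of_nat p * (v - A)" using AB(3) by (simp add: algebra_simps)
      also have "\<dots> = (1 - z) ^ j * ((1 - z) * ((1 - z) ^ i * U * (v - A)))"
        unfolding e(1) i by (simp add: power_add mult_ac)
      finally have B: "B = (1 - z) * ((1 - z) ^ i * U * (v - A))"
        using e0 j by simp
      obtain P where P: "B = evi P z" using AB(2) by (elim ZringE)
      obtain Q where Q: "evi P z = of_int (poly P 1) + (1 - z) * evi Q z" by (rule evi_eq_at_1)
      have "of_int (poly P 1) = B - (1 - z) * evi Q z" using Q P by simp
      also have "\<dots> = (1 - z) * ((1 - z) ^ i * U * (v - A) - evi Q z)"
        by (subst B) (simp only: right_diff_distrib)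
      finally have "of_int (poly P 1) = (1 - z) * ((1 - z) ^ i * U * (v - A) - evi Q z)" .
      moreover have "(1 - z) ^ i * U * (v - A) - evi Q z \<in> Oring z"
        by (intro Oring_diff Oring_Zring_mult Zring_subset_Oring[OF Zring_evi] v(2) Zring_subset_Oring[OF AB(1)]
          Zring_intros e(2))
      ultimately have "int p dvd poly P 1" by (rule Oring_dvd_imp_int_dvd[OF k z p e])
      then obtain c where c: "poly P 1 = int p * c" by auto
      have "of_nat p * v = of_nat p * (A + of_int c * (1 - z) ^ j) + (1 - z) ^ Suc j * evi Q z"
        unfolding AB(3) P Q c by (simp add: algebra_simps)
      then show "\<exists>A\<in>Zring z. \<exists>B\<in>Zring z. of_nat p * v = of_nat p * A + (1 - z) ^ Suc j * B"
        by (rule bexI[of _ "A + of_int c * (1 - z) ^ j", OF bexI[of _ "evi Q z"]]) (intro Zring_intros AB(1))+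
    qed
  qed
  then obtain A B where AB: "A \<in> Zring z" "B \<in> Zring z" "of_nat p * v = of_nat p * A + (1 - z) ^ e * B"
    by blast
  have "of_nat p * v = of_nat p * (A + inverse U * B)"
    unfolding AB(3) using U0 by (simp add: e(1) algebra_simps)
  then have "v = A + inverse U * B" using p0 by simp
  then show ?thesis using AB e by auto
qed

text \<open>Each of the two roots is a power of the other, so geometric sums give divisibility in
  both directions.\<close>

lemma one_minus_root_unit_multiple:
  assumes "k > 1" "z \<in> prim_roots k" "z' \<in> prim_roots k"
  shows "\<exists>u\<in>Zring z. inverse u \<in> Zring z \<and> 1 - z' = (1 - z) * u"
proof -
  have geo: "\<exists>u\<in>Zring a. 1 - b = (1 - a) * u" if ab: "a \<in> prim_roots k" "b \<in> prim_roots k" for a b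
  proof -
    obtain j where "b = a ^ j" using prim_roots_generate[OF ab(1), of b] ab(2) assms(1)
      by (auto simp: prim_roots_def)
    then have "1 - b = (1 - a) * (\<Sum>i<j. a ^ i)" by (simp add: one_diff_power_eq)
    then show ?thesis by (intro bexI[of _ "\<Sum>i<j. a ^ i"]) auto
  qed
  obtain u where u: "u \<in> Zring z" "1 - z' = (1 - z) * u" using geo[OF assms(2,3)] by auto
  obtain u' where u': "u' \<in> Zring z'" "1 - z = (1 - z') * u'" using geo[OF assms(3,2)] by auto
  have ne: "1 - z \<noteq> 0" using assms(1,2) by (auto simp: prim_roots_def dest: spec[of _ 1])
  have "(1 - z) * (u * u') = (1 - z) * 1" using u(2) u'(2) by (simp add: mult_ac)
  then have "u * u' = 1" using ne by (metis mult_left_cancel)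
  then have "inverse u = u'" by (metis inverse_unique)
  moreover have "z' \<in> Zring z" using u(2) u(1) by (metis Zring_0_1(2) Zring_diff Zring_mult Zring_self diff_diff_eq2 add_diff_cancel_left')
  ultimately show ?thesis using u u'(1) Zring_trans by blast
qed

text \<open>Differentiating X^(p^n) - 1 = cyclo_c(p^n) (X^(p^m) - 1), with n = m + 1, at 1 gives p^n
  on the left and the wanted value times p^m on the right.\<close>

lemma poly_cyclo_c_prime_power:
  assumes "prime p" "n > 0"
  shows "poly (cyclo_c (p ^ n)) 1 = of_nat p"
proof -
  obtain m where m: "n = Suc m" using assms(2) by (cases n) auto
  have p0: "p > 0" using assms(1) by (simp add: prime_gt_0_nat)
  have divs: "{e. e dvd p ^ n} = (\<lambda>i. p ^ i) ` {..n}" for n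
    using divides_primepow_nat[OF assms(1)] by auto
  have "{e. e dvd p ^ n} = insert (p ^ n) {e. e dvd p ^ m}"
    unfolding divs m atMost_Suc by simp
  moreover have "p ^ n \<notin> {e. e dvd p ^ m}"
    using prime_gt_1_nat[OF assms(1)] unfolding m by (auto dest: dvd_imp_le)
  ultimately have "monom 1 (p ^ n) - 1 = cyclo_c (p ^ n) * (\<Prod>e | e dvd p ^ m. cyclo_c e)"
    using monom_minus_1_eq_prod_cyclo_c[of "p ^ n"] p0 by simp
  also have "(\<Prod>e | e dvd p ^ m. cyclo_c e) = monom 1 (p ^ m) - 1"
    using monom_minus_1_eq_prod_cyclo_c[of "p ^ m"] p0 by simp
  finally have "poly (pderiv (monom 1 (p ^ n) - 1)) 1 = poly (pderiv (cyclo_c (p ^ n) * (monom 1 (p ^ m) - 1))) 1"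
    by simp
  then have "of_nat (p ^ n) = poly (cyclo_c (p ^ n)) 1 * of_nat (p ^ m)"
    by (simp add: pderiv_mult pderiv_diff pderiv_monom poly_monom)
  then show ?thesis using p0 by (simp add: m)
qed

text \<open>Total ramification: p is the product of 1 - z' over all primitive roots z', and each
  factor is a unit multiple of 1 - z.\<close>

lemma prime_factorization_one_minus_root:
  assumes p: "prime p" "n > 0" and z: "z \<in> prim_roots (p ^ n)"
  obtains e U where "e > 0" "of_nat p = (1 - z) ^ e * U" "U \<in> Zring z" "inverse U \<in> Zring z"
proof -
  let ?S = "prim_roots (p ^ n)"
  have k: "p ^ n > 1" using one_less_power[OF prime_gt_1_nat[OF p(1)] p(2)] .
  have "\<forall>z'\<in>?S. \<exists>u. u \<in> Zring z \<and> inverse u \<in> Zring z \<and> 1 - z' = (1 - z) * u"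
    using one_minus_root_unit_multiple[OF k z] by blast
  then obtain u where u: "\<And>z'. z' \<in> ?S \<Longrightarrow> u z' \<in> Zring z \<and> inverse (u z') \<in> Zring z \<and> 1 - z' = (1 - z) * u z'"
    by metis
  have "of_nat p = (\<Prod>z'\<in>?S. 1 - z')"
    using poly_cyclo_c_prime_power[OF p] by (simp add: poly_cyclo_c)
  also have "\<dots> = (\<Prod>z'\<in>?S. (1 - z) * u z')" using u by (intro prod.cong) auto
  also have "\<dots> = (1 - z) ^ card ?S * prod u ?S" by (simp add: prod.distrib)
  finally have eq: "of_nat p = (1 - z) ^ card ?S * prod u ?S" .
  have inv: "inverse (prod u ?S) = (\<Prod>z'\<in>?S. inverse (u z'))" using prod_inversef[of u ?S] by (simp add: o_def)
  have "p ^ n > 0" using k by linarith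
  then have "card ?S > 0" using finite_prim_roots[of "p ^ n"] z by (auto simp: card_gt_0_iff)
  moreover have "prod u ?S \<in> Zring z" using u by auto
  moreover have "inverse (prod u ?S) \<in> Zring z" unfolding inv using u by auto
  ultimately show ?thesis using that eq by blast
qed

text \<open>The sum 1 + X + ... + X^(b-1) vanishes at z^a and has value b at 1, so 1 - z^a divides
  b, and 1 - z divides 1 - z^a. Coprime choices of b make 1 - z a unit; for a prime power it bounds
  the denominator by p.\<close>

lemma order_over_one_minus_root:
  assumes "z \<in> prim_roots k" "k = a * b" "b > 1" "a > 0"
  shows "of_nat b / (1 - z) \<in> Zring z"
proof -
  let ?P = "\<Sum>i<b. monom 1 i :: int poly"
  have ne: "z ^ a \<noteq> 1" using assms unfolding prim_roots_def by (auto dest!: spec[of _ a])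
  have zk: "(z ^ a) ^ b = 1" using assms by (simp add: prim_roots_def flip: power_mult)
  have ev: "evi ?P x = (\<Sum>i<b. x ^ i)" for x
    by (simp add: hom_distribs poly_sum poly_monom)
  have "evi ?P (z ^ a) = 0"
    using one_diff_power_eq[of "z ^ a" b] zk ne unfolding ev by simp
  moreover have "poly ?P 1 = int b" by (simp add: poly_sum poly_monom)
  moreover obtain Q where "evi ?P (z ^ a) = of_int (poly ?P 1) + (1 - z ^ a) * evi Q (z ^ a)" by (rule evi_eq_at_1)
  ultimately have "of_nat b = (1 - z ^ a) * - evi Q (z ^ a)" by (simp add: algebra_simps)
  also have "\<dots> = (1 - z) * ((\<Sum>i<a. z ^ i) * - evi Q (z ^ a))"
    by (simp only: one_diff_power_eq[of z a] mult_ac)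
  finally have "of_nat b = (1 - z) * ((\<Sum>i<a. z ^ i) * - evi Q (z ^ a))" .
  moreover have "1 - z \<noteq> 0" using ne by auto
  ultimately have "of_nat b / (1 - z) = (\<Sum>i<a. z ^ i) * - evi Q (z ^ a)" by (simp add: field_simps)
  moreover have "evi Q (z ^ a) \<in> Zring z" by (rule Zring_trans[of "z ^ a"]) auto
  ultimately show ?thesis by (metis (no_types, lifting) Zring_mult Zring_sum Zring_power Zring_self Zring_uminus)
qed

section \<open>Complex conjugation modulo 1 - z\<close>

lemma cnj_prim_root: "z \<in> prim_roots k \<Longrightarrow> k > 0 \<Longrightarrow> cnj z = z ^ (k - 1)"
proof -
  assume z: "z \<in> prim_roots k" "k > 0"
  have "z * cnj z = 1" using prim_roots_norm[OF z] complex_norm_square[of z] by simp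
  moreover have "z * z ^ (k - 1) = 1" using z by (simp add: prim_roots_def flip: power_Suc)
  ultimately show ?thesis by (metis mult_left_cancel mult_zero_left zero_neq_one)
qed

lemma cnj_Zring:
  assumes "z \<in> prim_roots k" "k > 0" "w \<in> Zring z"
  shows "cnj w \<in> Zring z"
proof -
  obtain P where "w = evi P z" using assms(3) by (rule ZringE)
  then have "cnj w = evi P (z ^ (k - 1))" using cnj_prim_root[OF assms(1,2)] by (metis evi_cnj)
  then show ?thesis using Zring_trans[of "z ^ (k - 1)" z] by auto
qed

lemma cnj_Oring:
  assumes "z \<in> prim_roots k" "k > 0" "w \<in> Oring z"
  shows "cnj w \<in> Oring z"
proof -
  obtain D where D: "D > 0" "\<And>n. of_nat D * w ^ n \<in> Zring z" using OringE[OF assms(3)] by metis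
  show ?thesis
  proof (rule OringI[OF D(1)])
    show "of_nat D * cnj w ^ n \<in> Zring z" for n using cnj_Zring[OF assms(1,2) D(2)[of n]] by simp
  qed
qed

text \<open>With w = P(z), both w and its conjugate are congruent to the integer P(1), since 1 -
  \<open>cnj z\<close> is a unit times 1 - z.\<close>

lemma Zring_diff_cnj:
  assumes "z \<in> prim_roots k" "k > 1" "w \<in> Zring z"
  shows "(w - cnj w) / (1 - z) \<in> Zring z"
proof -
  have k0: "k > 0" using assms by simp
  obtain P where P: "w = evi P z" using assms(3) by (rule ZringE)
  obtain Q where Q: "evi P z = of_int (poly P 1) + (1 - z) * evi Q z" by (rule evi_eq_at_1)
  have ne: "1 - z \<noteq> 0" using assms(1,2) by (auto simp: prim_roots_def dest: spec[of _ 1])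
  have zz: "cnj z * z = 1" using prim_roots_norm[OF assms(1) k0] complex_norm_square[of z] by (simp add: mult.commute)
  then have "1 - cnj z = - ((1 - z) * cnj z)" by (simp add: algebra_simps)
  then have "w - cnj w = (1 - z) * (evi Q z + cnj z * cnj (evi Q z))"
    unfolding P Q by (simp add: algebra_simps)
  then have "(w - cnj w) / (1 - z) = evi Q z + cnj z * cnj (evi Q z)" using ne by simp
  then show ?thesis using cnj_Zring[OF assms(1) k0] by (metis Zring_add Zring_mult Zring_self Zring_evi)
qed

lemma not_primepow_imp_coprime_factors:
  fixes k :: nat
  assumes "k > 1" "\<not> (\<exists>p n. prime p \<and> n > 0 \<and> k = p ^ n)"
  obtains a b where "k = a * b" "coprime a b" "a > 1" "b > 1"
proof -
  obtain p where p: "prime p" "p dvd k" using assms(1) prime_factor_nat[of k] by auto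
  have k0: "k \<noteq> 0" "\<not> is_unit p" using assms(1) p by auto
  obtain b where b: "k = p ^ multiplicity p k * b" "\<not> p dvd b"
    using multiplicity_decompose'[OF k0] by metis
  have m: "multiplicity p k > 0" using p k0 by (simp add: multiplicity_gt_zero_iff)
  have "b \<noteq> 1" using assms(2) b(1) m p(1) by (metis mult.right_neutral)
  moreover have "b \<noteq> 0" using b k0 by (metis mult_0_right)
  moreover have "p ^ multiplicity p k > 1" using one_less_power[OF prime_gt_1_nat[OF p(1)] m] .
  moreover have "coprime (p ^ multiplicity p k) b" using b(2) p(1) by (simp add: prime_imp_coprime)
  ultimately show ?thesis using that[OF b(1)] by simp
qed

text \<open>If k has coprime factors a, b > 1, then 1 - z divides both and is a unit. If k is a
  power of p, local maximality removes all powers of p from a denominator of w. What remains is a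
  multiplier E prime to p, and the quotient is integral after multiplication by E and by p, hence
  integral by Bezout.\<close>

theorem Oring_diff_cnj:
  assumes z: "z \<in> prim_roots k" "k > 1" and w: "w \<in> Oring z"
  shows "(w - cnj w) / (1 - z) \<in> Oring z"
proof -
  have k0: "k > 0" using z by simp
  have dO: "w - cnj w \<in> Oring z" using cnj_Oring[OF z(1) k0 w] w by (intro Oring_diff)
  show ?thesis
  proof (cases "\<exists>p n. prime p \<and> n > 0 \<and> k = p ^ n")
    case False
    then obtain a b where ab: "k = a * b" "coprime a b" "a > 1" "b > 1"
      using not_primepow_imp_coprime_factors[OF z(2)] by metis
    obtain x y where xy: "x * int a + y * int b = 1"
      using ab(2) bezout_int[of "int a" "int b"] by auto
    have ab': "of_nat a / (1 - z) \<in> Zring z" "of_nat b / (1 - z) \<in> Zring z"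
      using order_over_one_minus_root[OF z(1), of b a] order_over_one_minus_root[OF z(1), of a b] ab
      by (auto simp: mult.commute)
    have "(of_int (x * int a + y * int b) :: complex) / (1 - z) =
        of_int x * (of_nat a / (1 - z)) + of_int y * (of_nat b / (1 - z))"
      by (simp add: add_divide_distrib)
    also have "\<dots> \<in> Zring z" by (intro Zring_intros ab')
    finally have "1 / (1 - z) \<in> Zring z" unfolding xy by simp
    then have "(1 / (1 - z)) * (w - cnj w) \<in> Oring z" using dO by (rule Oring_Zring_mult)
    then show ?thesis by simp
  next
    case True
    then obtain p n where p: "prime p" "n > 0" "k = p ^ n" by auto
    obtain e U where e: "e > 0" "of_nat p = (1 - z) ^ e * U" "U \<in> Zring z" "inverse U \<in> Zring z"
      using prime_factorization_one_minus_root[OF p(1,2)] z(1) p(3) by metis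
    have step: "of_nat (p ^ s * E) * w \<in> Zring z \<Longrightarrow> of_nat E * w \<in> Zring z" for s E
    proof (induction s)
      case (Suc s)
      have "of_nat (p ^ s * E) * w \<in> Zring z"
      proof (rule Zring_of_prime_mult[OF k0 z(1) p(1) e(2-4)])
        show "of_nat p * (of_nat (p ^ s * E) * w) \<in> Zring z" using Suc(2) by (simp add: mult_ac)
        show "of_nat (p ^ s * E) * w \<in> Oring z" using w by (rule Oring_Zring_mult[OF Zring_of_nat])
      qed
      then show ?case by (rule Suc(1))
    qed simp
    obtain D where D: "D > 0" "\<And>n. of_nat D * w ^ n \<in> Zring z" using OringE[OF w] by metis
    have "D \<noteq> 0" "\<not> is_unit p" using D p by auto
    then obtain E where E: "D = p ^ multiplicity p D * E" "\<not> p dvd E"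
      using multiplicity_decompose' by metis
    have "of_nat E * w \<in> Zring z" using step[of "multiplicity p D" E] D(2)[of 1] E(1) by simp
    from Zring_diff_cnj[OF z this] have 1: "of_nat E * ((w - cnj w) / (1 - z)) \<in> Oring z"
      by (intro Zring_subset_Oring) (simp add: algebra_simps)
    have "of_nat p / (1 - z) \<in> Zring z"
    proof -
      obtain m where "n = Suc m" using p(2) by (cases n) auto
      then show ?thesis using order_over_one_minus_root[OF z(1), of "p ^ m" p] p prime_gt_1_nat[OF p(1)]
        by (simp add: mult.commute)
    qed
    then have "(of_nat p / (1 - z)) * (w - cnj w) \<in> Oring z" using dO by (rule Oring_Zring_mult)
    then have 2: "of_nat p * ((w - cnj w) / (1 - z)) \<in> Oring z" by simp
    have "coprime (int p) (int E)" using E(2) p(1) by (simp add: prime_imp_coprime)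
    then obtain x y where xy: "x * int p + y * int E = 1" using bezout_int[of "int p" "int E"] by auto
    let ?g = "(w - cnj w) / (1 - z)"
    have "?g = of_int (x * int p + y * int E) * ?g" unfolding xy by simp
    also have "\<dots> = of_int x * (of_nat p * ?g) + of_int y * (of_nat E * ?g)"
      by (simp only: of_int_add of_int_mult of_int_of_nat_eq distrib_right mult.assoc)
    also have "\<dots> \<in> Oring z" by (intro Oring_add Oring_Zring_mult[OF Zring_of_int] 1 2)
    finally show ?thesis .
  qed
qed

section \<open>The cubic has no root in the cyclotomic field\<close>

declare poly_monom [simp]

text \<open>With u = t^2 + t + 7 the bound to reach is |t| |u|. For |t| > 2 the triangle inequality
  is enough. For |t| \<le> 2 the coefficient 7 dominates the cubic, so t is nearly proportional to 1
  - z and u nearly real.\<close>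

lemma norm_diff_cnj_less:
  fixes t z :: complex
  assumes z: "norm z = 1" "z \<noteq> 1" and t: "t * (t\<^sup>2 + t + 7) = 1 - z"
  shows "norm ((t\<^sup>2 + t + 7) - cnj (t\<^sup>2 + t + 7)) < norm (1 - z)"
proof -
  define u where "u = t\<^sup>2 + t + 7"
  have tu: "t * u = 1 - z" using t by (simp add: u_def)
  then have tn: "norm t > 0" "norm u > 0" using z(2) by auto
  have ntu: "norm (1 - z) = norm t * norm u" using tu by (metis norm_mult)
  show ?thesis
  proof (cases "norm t > 2")
    case True
    have "norm (u - cnj u) \<le> norm u + norm (cnj u)" by (rule norm_triangle_ineq4)
    also have "\<dots> = 2 * norm u" by simp
    also have "\<dots> < norm t * norm u" using True tn by simp
    finally show ?thesis using ntu by (simp add: u_def)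
  next
    case False
    \<comment> \<open>The conjugate of 1 - z is -(1 - z)/z, so d would vanish if t were a real
      multiple of 1 - z. It measures the failure of u to be real: |d| |u| = |t| |u -
      \<open>cnj u\<close>|.\<close>
    define d where "d = t + z * cnj t"
    have zz: "z * cnj z = 1" using complex_norm_square[of z] z(1) by simp
    have "cnj t * cnj u = 1 - cnj z" using arg_cong[OF tu, of cnj] by simp
    then have "z * (cnj t * cnj u) = z * (1 - cnj z)" by simp
    also have "\<dots> = - (t * u)" unfolding tu using zz by (simp add: right_diff_distrib)
    finally have c: "z * (cnj t * cnj u) = - (t * u)" .
    then have "d * cnj u = t * (cnj u - u)" by (simp add: d_def algebra_simps)
    then have "norm d * norm u = norm t * norm (u - cnj u)"
      by (metis complex_mod_cnj norm_minus_commute norm_mult)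
    \<comment> \<open>Substitute 7t = tu - t^2 (1 + t) and its conjugate; the terms in u cancel by
      \<open>c\<close>. With |1 + t| \<le> 3 this yields 7 |d| \<le> 6 |t|^2.\<close>
    moreover have "7 * d = - (t\<^sup>2 * (1 + t)) - z * ((cnj t)\<^sup>2 * (1 + cnj t))"
      using c by (simp add: d_def u_def algebra_simps power2_eq_square)
    then have "7 * norm d = norm (- (t\<^sup>2 * (1 + t)) - z * ((cnj t)\<^sup>2 * (1 + cnj t)))"
      by (metis norm_mult norm_numeral)
    moreover have "\<dots> \<le> norm (- (t\<^sup>2 * (1 + t))) + norm (z * ((cnj t)\<^sup>2 * (1 + cnj t)))"
      by (rule norm_triangle_ineq4)
    moreover have "norm (1 + cnj t) = norm (1 + t)"
      by (metis complex_cnj_add complex_cnj_one complex_mod_cnj)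
    ultimately have d: "7 * norm d \<le> 2 * ((norm t)\<^sup>2 * norm (1 + t))" 
      and du: "norm d * norm u = norm t * norm (u - cnj u)"
      using z(1) by (simp_all add: norm_mult norm_power mult_ac)
    have "norm (1 + t) \<le> 3" using norm_triangle_ineq[of 1 t] False by simp
    then have "(norm t)\<^sup>2 * norm (1 + t) \<le> (norm t)\<^sup>2 * 3" by (intro mult_left_mono) auto
    then have "7 * norm d \<le> 6 * (norm t)\<^sup>2" using d by linarith
    also have "\<dots> < 7 * (norm t)\<^sup>2" using tn by simp
    finally have "norm d < (norm t)\<^sup>2" by simp
    then have "norm t * norm (u - cnj u) < (norm t)\<^sup>2 * norm u"
      unfolding du[symmetric] using tn by simp
    then have "norm (u - cnj u) < norm t * norm u" using tn by (simp add: power2_eq_square)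
    then show ?thesis using ntu by (simp add: u_def)
  qed
qed

text \<open>Eliminating t leaves a cubic for the real number v = u with coefficients in z. Its
  imaginary part forces v = -2(1 - a), where a is the real part of z. Its real part then gives 8(1 -
  a)^2 + 28(1 - a) = 2, and |1 - z|^2 = 2(1 - a) is at most 1/7.\<close>

lemma norm_less_1_if_real:
  fixes t z :: complex
  assumes z: "norm z = 1" "Im z \<noteq> 0" and t: "t * (t\<^sup>2 + t + 7) = 1 - z"
    and r: "t\<^sup>2 + t + 7 = cnj (t\<^sup>2 + t + 7)"
  shows "norm (1 - z) < 1"
proof -
  define u where "u = t\<^sup>2 + t + 7"
  define a b where "a = Re z" and "b = Im z"
  obtain v where v: "u = of_real v" using r by (metis Reals_cases Reals_cnj_iff u_def)
  have tu: "t * u = 1 - z" using t by (simp add: u_def)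
  have "u ^ 3 = (t\<^sup>2 + t + 7) * u\<^sup>2" by (simp add: u_def power3_eq_cube power2_eq_square)
  also have "\<dots> = (t * u)\<^sup>2 + (t * u) * u + 7 * u\<^sup>2" by (simp add: algebra_simps power2_eq_square)
  finally have eq: "u ^ 3 = (1 - z)\<^sup>2 + (1 - z) * u + 7 * u\<^sup>2" unfolding tu .
  have ab: "a\<^sup>2 + b\<^sup>2 = 1" using z(1) by (simp add: a_def b_def cmod_def)
  have zab: "z = Complex a b" by (simp add: a_def b_def)
  have "Im (u ^ 3) = Im ((1 - z)\<^sup>2 + (1 - z) * u + 7 * u\<^sup>2)" "Re (u ^ 3) = Re ((1 - z)\<^sup>2 + (1 - z) * u + 7 * u\<^sup>2)"
    unfolding eq by simp_all
  then have im: "b * (2 * (1 - a) + v) = 0" and re: "v ^ 3 = (1 - a)\<^sup>2 - b\<^sup>2 + (1 - a) * v + 7 * v\<^sup>2"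
    unfolding v zab by (simp_all add: power2_eq_square power3_eq_cube algebra_simps)
  have v': "v = - 2 * (1 - a)" using im z(2) by (simp add: b_def)
  have b2: "b\<^sup>2 = (1 - a) * (1 + a)" using ab by (simp add: algebra_simps power2_eq_square)
  have "(1 - a) * (8 * (1 - a)\<^sup>2 + 28 * (1 - a) - 2) = 0"
    using re unfolding v' b2 by (simp add: power2_eq_square power3_eq_cube algebra_simps)
  moreover have "1 - a \<noteq> 0"
    using ab z(2) by (auto simp: b_def)
  ultimately have "8 * (1 - a)\<^sup>2 + 28 * (1 - a) = 2" by simp
  moreover have "8 * (1 - a)\<^sup>2 \<ge> 0" by simp
  ultimately have "28 * (1 - a) \<le> 2" by linarith
  moreover have "(norm (1 - z))\<^sup>2 = (1 - a)\<^sup>2 + b\<^sup>2"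
    unfolding cmod_power2 by (simp add: a_def b_def)
  moreover have "(1 - a)\<^sup>2 + b\<^sup>2 = 2 * (1 - a)"
    using ab by (simp add: power2_eq_square algebra_simps)
  ultimately have "(norm (1 - z))\<^sup>2 < 1\<^sup>2" by simp
  then show ?thesis by (rule power2_less_imp_less) simp
qed

text \<open>The equation is a monic cubic for t, so all powers of t are combinations of 1, t and t^2
  over Z[z]. A common denominator of t and t^2 serves for every power.\<close>

lemma Oring_of_root:
  assumes t: "t * (t\<^sup>2 + t + 7) = 1 - z" and T: "t = evr T z"
  shows "t \<in> Oring z"
proof -
  obtain c :: nat and Q where c: "c > 0" "smult (of_nat c) T = map_poly of_int Q" using clear_denominators by blast
  obtain d :: nat and R where d: "d > 0" "smult (of_nat d) (T\<^sup>2) = map_poly of_int R" using clear_denominators by blast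
  have ct: "of_nat c * t = evi Q z" using c(2) T by (metis evr_of_int evr_simps(9) of_rat_of_nat_eq)
  have dt: "of_nat d * t\<^sup>2 = evi R z" using d(2) T by (metis evr_of_int evr_simps(5,9) of_rat_of_nat_eq)
  have "of_nat (c * d) * t ^ n \<in> Zring z" for n
  proof (induction n rule: less_induct)
    case (less n)
    have t3: "t ^ 3 = (1 - z) - 7 * t - t\<^sup>2"
      using t by (simp add: power3_eq_cube power2_eq_square algebra_simps)
    consider "n = 0" | "n = 1" | "n = 2" | m where "n = m + 3"
      by (metis One_nat_def Suc_1 add.commute add_2_eq_Suc' le_add_diff_inverse2 less_Suc0 less_Suc_eq linorder_not_less numeral_3_eq_3)
    then show ?case
    proof cases
      case 1 then show ?thesis by auto
    next
      case 2
      have "of_nat (c * d) * t = of_nat d * evi Q z" by (simp flip: ct)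
      then show ?thesis using 2 by (simp only: power_one_right) (intro Zring_intros)
    next
      case 3
      have "of_nat (c * d) * t\<^sup>2 = of_nat c * evi R z" by (simp flip: dt)
      then show ?thesis using 3 by (simp only:) (intro Zring_intros)
    next
      case (4 m)
      have "of_nat (c * d) * t ^ n = (1 - z) * (of_nat (c * d) * t ^ m)
        - 7 * (of_nat (c * d) * t ^ (m + 1)) - of_nat (c * d) * t ^ (m + 2)"
        unfolding 4 power_add t3 by (simp add: algebra_simps)
      also have "\<dots> \<in> Zring z"
      proof -
        have "of_nat (c * d) * t ^ m \<in> Zring z" "of_nat (c * d) * t ^ (m + 1) \<in> Zring z"
          "of_nat (c * d) * t ^ (m + 2) \<in> Zring z"
          using less[of m] less[of "m + 1"] less[of "m + 2"] 4 by auto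
        moreover have "(7 :: complex) \<in> Zring z" using Zring_of_nat[of 7 z] by simp
        ultimately show ?thesis by (intro Zring_diff Zring_mult[of _ z "of_nat (c * d) * _"] Zring_0_1 Zring_self)
      qed
      finally show ?thesis .
    qed
  qed
  then show ?thesis using c(1) d(1) by (intro OringI[of "c * d"]) auto
qed

lemma prim_root_Im_nonzero:
  assumes "k > 2" "z \<in> prim_roots k"
  shows "Im z \<noteq> 0"
proof
  assume "Im z = 0"
  moreover have "norm z = 1" using prim_roots_norm assms by auto
  ultimately have "z = 1 \<or> z = -1"
    by (auto simp: complex_eq_iff cmod_def)
  then have "z\<^sup>2 = 1" by auto
  then show False using assms unfolding prim_roots_def by auto
qed

theorem no_root_in_cyclotomic_field:
  assumes k: "k > 1" and z: "z \<in> prim_roots k"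
  shows "evr T z * ((evr T z)\<^sup>2 + evr T z + 7) \<noteq> 1 - z"
proof
  assume eq: "evr T z * ((evr T z)\<^sup>2 + evr T z + 7) = 1 - z"
  define U where "U = T\<^sup>2 + T + [:7:]"
  have k0: "k > 0" using k by simp
  have evU: "evr U x = (evr T x)\<^sup>2 + evr T x + 7" for x by (simp add: U_def of_rat_numeral_eq)
  have eq': "evr T z' * ((evr T z')\<^sup>2 + evr T z' + 7) = 1 - z'" if "z' \<in> prim_roots k" for z'
  proof -
    have "evr (T * U - (1 - monom 1 1)) z = 0" using eq by (simp add: evU)
    from conjugate_root_rat[OF k0 z that this] show ?thesis by (simp add: evU)
  qed
  have tO: "evr T z \<in> Oring z" by (rule Oring_of_root[OF eq refl])
  have ne1: "z' \<noteq> 1" if "z' \<in> prim_roots k" for z' using that k by (auto simp: prim_roots_def dest: spec[of _ 1])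
  have uO: "evr U z \<in> Oring z"
    unfolding evU by (intro Oring_add Oring_power tO) (use Zring_subset_Oring[OF Zring_of_nat[of 7 z]] in simp)
  \<comment> \<open>Conjugation is the substitution z -> z^(k-1), so u minus its conjugate is again
    a rational polynomial at each primitive root, as the norm argument requires.\<close>
  define V where "V = U - pcompose U (monom 1 (k - 1))"
  have evV: "evr V z' = evr U z' - cnj (evr U z')" if "z' \<in> prim_roots k" for z'
    using cnj_prim_root[OF that k0] by (simp add: V_def flip: evr_cnj)
  have "(evr U z - cnj (evr U z)) / (1 - z) = 0"
  proof (rule Oring_eq_0[OF k0 z Oring_diff_cnj[OF z k uO]])
    show "(evr U z - cnj (evr U z)) / (1 - z) * evr (1 - monom 1 1) z = evr V z"
      using ne1[OF z] by (simp add: evV[OF z])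
    fix z' assume z': "z' \<in> prim_roots k"
    have "norm (evr U z' - cnj (evr U z')) < norm (1 - z')"
      unfolding evU by (rule norm_diff_cnj_less[OF prim_roots_norm[OF z' k0] ne1[OF z'] eq'[OF z']])
    then show "norm (evr V z') < norm (evr (1 - monom 1 1) z')"
      using evV[OF z'] by simp
  qed
  then have "evr V z = 0" using ne1[OF z] evV[OF z] by simp
  then have real: "evr U z' = cnj (evr U z')" if "z' \<in> prim_roots k" for z'
    using conjugate_root_rat[OF k0 z that] evV[OF that] by simp
  show False
  proof (cases "k = 2")
    case False
    then have k2: "k > 2" using k by simp
    have "1 - z = 0"
    proof (rule Oring_eq_0[OF k0 z, of _ 1 "1 - monom 1 1"])
      show "1 - z \<in> Oring z" by (intro Zring_subset_Oring Zring_intros)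
      fix z' assume z': "z' \<in> prim_roots k"
      have "norm (1 - z') < 1"
        using norm_less_1_if_real[OF prim_roots_norm[OF z' k0] prim_root_Im_nonzero[OF k2 z'] eq'[OF z']]
          real[OF z'] by (simp add: evU)
      then show "norm (evr (1 - monom 1 1) z') < norm (evr 1 z')" by simp
    qed simp
    then show False using ne1[OF z] by simp
  next
    case True
    \<comment> \<open>Here z = -1 is the only primitive root, and reality of u says nothing. The
      value s of T is a real root of s(s^2 + s + 7) = 2, so 0 < s < 1; but s is integral with itself
      as only conjugate, hence 0.\<close>
    have m1: "z' = -1" if "z' \<in> prim_roots k" for z'
    proof -
      have "z'\<^sup>2 = 1" using that True by (simp add: prim_roots_def)
      then show ?thesis using ne1[OF that] by (simp add: power2_eq_1_iff)
    qed
    have "cnj (evr T (-1)) = evr T (-1)" by (metis evr_cnj complex_cnj_one complex_cnj_minus)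
    then obtain s where s: "evr T (-1) = of_real s" by (metis Reals_cases Reals_cnj_iff)
    have "complex_of_real (s * (s\<^sup>2 + s + 7)) = of_real 2" using eq m1[OF z] s by simp
    then have s2: "s * (s\<^sup>2 + s + 7) = 2" using of_real_eq_iff by blast
    have pos: "s\<^sup>2 + s + 7 > 2"
    proof -
      have "s\<^sup>2 + s + 7 = (s + 1/2)\<^sup>2 + 27/4" by (simp add: power2_eq_square algebra_simps)
      moreover have "(s + 1/2)\<^sup>2 \<ge> 0" by simp
      ultimately show ?thesis by linarith
    qed
    have "s = 2 / (s\<^sup>2 + s + 7)" using s2 pos by (simp add: field_simps)
    then have s0: "0 < s" using pos by (smt (verit) divide_pos_pos)
    have s1: "s < 1"
    proof (rule ccontr)
      assume "\<not> s < 1"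
      then have "1 * (s\<^sup>2 + s + 7) \<le> s * (s\<^sup>2 + s + 7)" using pos by (intro mult_right_mono) auto
      with s2 pos show False by simp
    qed
    have "evr T z = 0"
      by (rule Oring_eq_0[OF k0 z tO, of 1 T]) (use m1 s s0 s1 in auto)
    then show False using eq ne1[OF z] by simp
  qed
qed

section \<open>Irreducibility of the composed cyclotomic polynomial\<close>

definition Kfield :: "complex \<Rightarrow> complex set" where
  "Kfield z = range (\<lambda>P. evr P z)"

lemma KfieldE:
  assumes "a \<in> Kfield z"
  obtains P where "a = evr P z"
  using assms by (auto simp: Kfield_def)

lemma Kfield_evr [simp]: "evr P z \<in> Kfield z" by (auto simp: Kfield_def)

lemma Kfield_diff: "a \<in> Kfield z \<Longrightarrow> b \<in> Kfield z \<Longrightarrow> a - b \<in> Kfield z"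
  by (elim KfieldE) (metis Kfield_evr evr_simps(2))

lemma Kfield_mult: "a \<in> Kfield z \<Longrightarrow> b \<in> Kfield z \<Longrightarrow> a * b \<in> Kfield z"
  by (elim KfieldE) (metis Kfield_evr evr_simps(3))

lemma Kfield_of_rat [simp]: "of_rat c \<in> Kfield z"
  using Kfield_evr[of "[:c:]" z] by simp

lemma Kfield_base [simp]: "1 \<in> Kfield z" "numeral n \<in> Kfield z" "z \<in> Kfield z"
  using Kfield_of_rat[of 1 z] Kfield_of_rat[of "numeral n" z] Kfield_evr[of "monom 1 1" z]
  by (simp_all add: of_rat_numeral_eq)

abbreviation cyclo_rat :: "nat \<Rightarrow> rat poly" where
  "cyclo_rat k \<equiv> map_poly of_int (cyclo k)"

lemma map_poly_cyclo_rat: "k > 0 \<Longrightarrow> map_poly of_rat (cyclo_rat k) = cyclo_c k"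
  by (simp add: map_poly_map_poly o_def flip: map_poly_cyclo)

lemma evr_cyclo_rat_eq_0_iff: "k > 0 \<Longrightarrow> evr (cyclo_rat k) x = 0 \<longleftrightarrow> x \<in> prim_roots k"
  using finite_prim_roots[of k] by (simp only: map_poly_cyclo_rat poly_cyclo_c) auto

lemma prod_linear_factors_dvd:
  fixes p :: "'a :: field poly"
  assumes "finite S" "\<And>a. a \<in> S \<Longrightarrow> poly p a = 0"
  shows "(\<Prod>a\<in>S. [:-a, 1:]) dvd p"
  using assms
proof (induction S rule: finite_induct)
  case (insert a S)
  then obtain q where q: "p = (\<Prod>a\<in>S. [:-a, 1:]) * q" by auto
  have "poly (\<Prod>a\<in>S. [:-a, 1:]) a \<noteq> 0"
    using insert(1,2) by (auto simp: poly_prod)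
  then have "poly q a = 0" using insert(4)[of a] unfolding q by simp
  then have "[:-a, 1:] dvd q" by (simp only: poly_eq_0_iff_dvd)
  then have "(\<Prod>a\<in>S. [:-a, 1:]) * [:-a, 1:] dvd p" unfolding q by (rule mult_dvd_mono[OF dvd_refl])
  then show ?case by (subst prod.insert[OF insert(1,2)]) (simp only: mult.commute)
qed simp

lemma cyclo_rat_dvd:
  assumes "k > 0" "z \<in> prim_roots k" "evr R z = 0"
  shows "cyclo_rat k dvd R"
proof -
  have "cyclo_c k dvd map_poly of_rat R"
    unfolding cyclo_c_def using conjugate_root_rat[OF assms(1,2) _ assms(3)] finite_prim_roots[OF assms(1)]
    by (intro prod_linear_factors_dvd) auto
  then show ?thesis
    using map_poly_cyclo_rat[OF assms(1)] by (metis of_rat_hom.dvd_map_poly_hom_imp_dvd)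
qed

text \<open>A nonconstant common divisor of P and the cyclotomic polynomial would vanish at some
  primitive root, hence at z by conjugacy. So the two are coprime, and Bezout gives the
  inverse.\<close>

lemma Kfield_inverse:
  assumes "k > 0" "z \<in> prim_roots k" "a \<in> Kfield z"
  shows "inverse a \<in> Kfield z"
proof (cases "a = 0")
  case False
  obtain P where P: "a = evr P z" using assms(3) by (rule KfieldE)
  let ?C = "cyclo_rat k"
  have C0: "?C \<noteq> 0" using lead_coeff_cyclo[OF assms(1)] by auto
  define g where "g = gcd P ?C"
  have gz: "evr g z \<noteq> 0"
  proof
    assume "evr g z = 0"
    moreover have "g dvd P" by (simp add: g_def)
    ultimately have "evr P z = 0" by (auto elim!: dvdE)
    then show False using P False by simp
  qed
  have "degree g = 0"
  proof (rule ccontr)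
    assume "degree g \<noteq> 0"
    then obtain x where x: "evr g x = 0"
      using fundamental_theorem_of_algebra[of "map_poly of_rat g"] by (auto simp: constant_degree)
    have "g dvd ?C" by (simp add: g_def)
    then have "evr ?C x = 0" using x by (metis dvdE evr_simps(3) mult_zero_left)
    then have "x \<in> prim_roots k" using evr_cyclo_rat_eq_0_iff[OF assms(1)] by simp
    then have "evr g z = 0" using conjugate_root_rat[OF assms(1) _ assms(2) x] by simp
    with gz show False by simp
  qed
  moreover have "g \<noteq> 0" using C0 by (simp add: g_def)
  ultimately have "is_unit g" by (simp add: is_unit_iff_degree)
  then have "coprime P ?C" unfolding g_def by (simp only: is_unit_gcd)
  then obtain x y where xy: "x * P + y * ?C = 1"
    using bezout_coefficients_fst_snd[of P ?C] by (metis coprime_imp_gcd_eq_1)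
  have "evr (x * P + y * ?C) z = 1" unfolding xy by simp
  moreover have "evr ?C z = 0" using evr_cyclo_rat_eq_0_iff[OF assms(1)] assms(2) by simp
  ultimately have "evr x z * a = 1" by (simp only: evr_simps P) simp
  then have "inverse a = evr x z" by (metis inverse_unique mult.commute)
  then show ?thesis by simp
qed (use assms in simp)

section \<open>The multiplier cubic over the cyclotomic field\<close>

definition mult_poly :: "rat poly" where "mult_poly = [:1, -7, -1, -1:]"

lemma evr_mult_poly: "evr mult_poly x = 1 - x * (x\<^sup>2 + x + 7)"
  by (simp add: mult_poly_def hom_distribs of_rat_numeral_eq of_rat_minus algebra_simps power2_eq_square)

text \<open>Expansion in base L = \<open>mult_poly\<close> with digits of degree below 3, regrouped
  by powers of X. At a root x with L(x) = z, vanishing of A thus becomes a relation between 1, x,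
  x^2 over Q(z).\<close>

lemma digit_expansion:
  fixes A :: "rat poly"
  shows "\<exists>R0 R1 R2. A = pcompose R0 mult_poly + monom 1 1 * pcompose R1 mult_poly + monom 1 2 * pcompose R2 mult_poly"
proof (induction "degree A" arbitrary: A rule: less_induct)
  case less
  let ?L = mult_poly
  have L: "?L \<noteq> 0" "degree ?L = 3" by (simp_all add: mult_poly_def)
  define M where "M = A mod ?L"
  have "degree M < 3" using degree_mod_less[OF L(1), of A] L(2) by (auto simp: M_def)
  then have M: "M = [:coeff M 0, coeff M 1, coeff M 2:]"
    by (intro poly_eqI) (auto simp: coeff_pCons coeff_eq_0 numeral_2_eq_2 split: nat.split)
  have M': "M = [:coeff M 0:] + monom 1 1 * [:coeff M 1:] + monom 1 2 * [:coeff M 2:]"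
    by (subst M) (simp add: monom_Suc numeral_2_eq_2)
  have A: "A = (A div ?L) * ?L + M" by (simp add: M_def)
  show ?case
  proof (cases "degree A < 3")
    case True
    then have "A = M" using L by (simp add: M_def mod_poly_less)
    then show ?thesis
      by (intro exI[of _ "[:coeff M 0:]"] exI[of _ "[:coeff M 1:]"] exI[of _ "[:coeff M 2:]"])
        (use M' in simp)
  next
    case False
    have "degree (A div ?L) < degree A"
    proof (cases "A div ?L = 0")
      case nz: False
      then have d: "degree (A div ?L * ?L) = degree (A div ?L) + 3" using L by (simp add: degree_mult_eq)
      have "degree A = degree (A div ?L * ?L)"
        by (subst A, rule degree_add_eq_left) (use d \<open>degree M < 3\<close> in simp)
      then show ?thesis using d by simp
    qed (use False in simp)
    from less[OF this] obtain R0 R1 R2 where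
      R: "A div ?L = pcompose R0 ?L + monom 1 1 * pcompose R1 ?L + monom 1 2 * pcompose R2 ?L" by blast
    have pc: "pcompose (R * [:0, 1:] + [:c:]) ?L = pcompose R ?L * ?L + [:c:]" for R and c :: rat
      by (simp add: pcompose_add pcompose_mult pcompose_pCons)
    have "A = pcompose (R0 * [:0, 1:] + [:coeff M 0:]) ?L + monom 1 1 * pcompose (R1 * [:0, 1:] + [:coeff M 1:]) ?L
      + monom 1 2 * pcompose (R2 * [:0, 1:] + [:coeff M 2:]) ?L"
      unfolding pc by (subst A, subst R, subst M') (simp only: algebra_simps)
    then show ?thesis by blast
  qed
qed

text \<open>A linear relation puts x itself into the field. A quadratic one must divide the cubic,
  since the linear remainder m y + n also vanishes at x; the cofactor y + 1 - p then gives the root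
  p - 1 in the field.\<close>

lemma cubic_root_degree_3:
  assumes k: "k > 1" "z \<in> prim_roots k"
    and abc: "a \<in> Kfield z" "b \<in> Kfield z" "c \<in> Kfield z"
    and x: "x * (x\<^sup>2 + x + 7) = 1 - z" "a + b * x + c * x\<^sup>2 = 0"
  shows "a = 0 \<and> b = 0 \<and> c = 0"
proof (rule ccontr)
  assume *: "\<not> (a = 0 \<and> b = 0 \<and> c = 0)"
  have k0: "k > 0" using k by simp
  have div: "u / v \<in> Kfield z" if "u \<in> Kfield z" "v \<in> Kfield z" for u v
    using Kfield_mult[OF that(1) Kfield_inverse[OF k0 k(2) that(2)]] by (simp add: divide_inverse)
  have no: "y * (y\<^sup>2 + y + 7) \<noteq> 1 - z" if "y \<in> Kfield z" for y
    using that no_root_in_cyclotomic_field[OF k] by (elim KfieldE) metis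
  have lin: False if "m \<in> Kfield z" "n \<in> Kfield z" "m \<noteq> 0" "m * x + n = 0" for m n
  proof -
    have "m * x = 0 - n" using that(4) by (simp add: eq_neg_iff_add_eq_0)
    then have "x = (0 - n) / m" using that(3) by (metis nonzero_mult_div_cancel_left)
    moreover have "0 \<in> Kfield z" using Kfield_of_rat[of 0 z] by simp
    then have "(0 - n) / m \<in> Kfield z" using that(1,2) by (intro div Kfield_diff)
    ultimately show False using no[of x] x(1) by simp
  qed
  show False
  proof (cases "c = 0")
    case True
    then have "b * x + a = 0" using x(2) by (simp add: add.commute)
    then have "b = 0" using lin[OF abc(2,1)] by blast
    then show False using x(2) * True by simp
  next
    case False
    define p q where "p = b / c" and "q = a / c"
    have pq: "p \<in> Kfield z" "q \<in> Kfield z" using abc div by (auto simp: p_def q_def)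
    define m n where "m = 7 - q - p * (1 - p)" and "n = z - 1 - q * (1 - p)"
    have mn: "m \<in> Kfield z" "n \<in> Kfield z"
      unfolding m_def n_def by (intro Kfield_diff Kfield_mult Kfield_base pq)+
    have id: "y * (y\<^sup>2 + y + 7) - (1 - z) = (y\<^sup>2 + p * y + q) * (y + 1 - p) + (m * y + n)" for y
      by (simp add: m_def n_def algebra_simps power2_eq_square)
    have "x\<^sup>2 + p * x + q = (a + b * x + c * x\<^sup>2) / c" using False by (simp add: p_def q_def add_divide_distrib)
    then have "x\<^sup>2 + p * x + q = 0" unfolding x(2) by simp
    then have "m * x + n = 0" using id[of x] unfolding x(1) by simp
    then have "m = 0" using lin[OF mn] by blast
    with \<open>m * x + n = 0\<close> have "n = 0" by simp
    then have "(p - 1) * ((p - 1)\<^sup>2 + (p - 1) + 7) = 1 - z" using id[of "p - 1"] unfolding \<open>m = 0\<close> \<open>n = 0\<close> by simp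
    moreover have "p - 1 \<in> Kfield z" by (intro Kfield_diff Kfield_base pq)
    ultimately show False using no by blast
  qed
qed

definition cyclo_mult :: "nat \<Rightarrow> rat poly" where
  "cyclo_mult k = pcompose (cyclo_rat k) mult_poly"

lemma evr_cyclo_mult_eq_0_iff: "k > 0 \<Longrightarrow> evr (cyclo_mult k) x = 0 \<longleftrightarrow> evr mult_poly x \<in> prim_roots k"
  unfolding cyclo_mult_def evr_simps(10) by (rule evr_cyclo_rat_eq_0_iff)

lemma evr_eq_0_if_dvd: "P dvd Q \<Longrightarrow> evr P x = 0 \<Longrightarrow> evr Q x = 0"
  by (auto elim!: dvdE)

lemma degree_cyclo_mult: "k > 0 \<Longrightarrow> degree (cyclo_mult k) = 3 * card (prim_roots k)"
  by (simp add: cyclo_mult_def degree_pcompose degree_cyclo mult_poly_def)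

lemma degree_cyclo_mult_pos: "k > 0 \<Longrightarrow> degree (cyclo_mult k) > 0"
  using prim_roots_nonempty[of k] finite_prim_roots[of k] by (auto simp: degree_cyclo_mult card_gt_0_iff)

lemma cyclo_mult_has_root:
  assumes "k > 0"
  shows "\<exists>x. evr mult_poly x \<in> prim_roots k"
proof -
  have "\<not> constant (poly (map_poly of_rat (cyclo_mult k) :: complex poly))"
    using degree_cyclo_mult_pos[OF assms] by (simp add: constant_degree)
  then obtain x where "evr (cyclo_mult k) x = 0"
    using fundamental_theorem_of_algebra by blast
  then show ?thesis using evr_cyclo_mult_eq_0_iff[OF assms] by blast
qed

text \<open>Makes \<open>cyclo_mult k\<close> the minimal polynomial of x up to a scalar:
  independence of 1, x, x^2 forces each digit of A to vanish at z, so the cyclotomic polynomial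
  divides every digit.\<close>

theorem cyclo_mult_dvd:
  assumes k: "k > 1" and x: "evr mult_poly x \<in> prim_roots k" and A: "evr A x = 0"
  shows "cyclo_mult k dvd A"
proof -
  have k0: "k > 0" using k by simp
  define z where "z = evr mult_poly x"
  obtain R0 R1 R2 where R: "A = pcompose R0 mult_poly + monom 1 1 * pcompose R1 mult_poly + monom 1 2 * pcompose R2 mult_poly"
    using digit_expansion by blast
  have "x * (x\<^sup>2 + x + 7) = 1 - z" by (simp add: z_def evr_mult_poly)
  moreover have "evr R0 z + evr R1 z * x + evr R2 z * x\<^sup>2 = 0"
    using A unfolding R by (simp add: z_def mult.commute)
  ultimately have "evr R0 z = 0 \<and> evr R1 z = 0 \<and> evr R2 z = 0"
    by (intro cubic_root_degree_3[OF k x[folded z_def]]) auto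
  then have "cyclo_rat k dvd R0" "cyclo_rat k dvd R1" "cyclo_rat k dvd R2"
    using cyclo_rat_dvd[OF k0 x[folded z_def]] by auto
  moreover have "cyclo_mult k dvd pcompose R mult_poly" if "cyclo_rat k dvd R" for R
    using that unfolding cyclo_mult_def by (auto elim!: dvdE simp: pcompose_mult)
  ultimately show ?thesis unfolding R by (intro dvd_add dvd_mult) auto
qed

theorem prime_elem_cyclo_mult:
  assumes "k > 1"
  shows "prime_elem (cyclo_mult k)"
proof (rule prime_elemI)
  have k0: "k > 0" using assms by simp
  have d: "degree (cyclo_mult k) \<noteq> 0" using degree_cyclo_mult_pos[OF k0] by (rule gr_implies_not_zero)
  then show nz: "cyclo_mult k \<noteq> 0" by (metis degree_0)
  show "\<not> is_unit (cyclo_mult k)" using d unfolding is_unit_iff_degree[OF nz] .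
  fix A B assume "cyclo_mult k dvd A * B"
  obtain x where x: "evr mult_poly x \<in> prim_roots k" using cyclo_mult_has_root[OF k0] by blast
  then have "evr (A * B) x = 0"
    using evr_eq_0_if_dvd[OF \<open>cyclo_mult k dvd A * B\<close>] evr_cyclo_mult_eq_0_iff[OF k0] by simp
  then have "evr A x = 0 \<or> evr B x = 0" by simp
  then show "cyclo_mult k dvd A \<or> cyclo_mult k dvd B" using cyclo_mult_dvd[OF assms x] by auto
qed

lemma evr_minus_X: "evr [:0, -1:] x = - x"
proof -
  have "[:0, -1 :: rat:] = - monom 1 1" by (intro poly_eqI) (simp add: coeff_pCons split: nat.split)
  then show ?thesis by (simp only: evr_simps) simp
qed

text \<open>Otherwise L(x) and L(-x) would both have modulus 1 at every root x. Their sum is 2(1 -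
  x^2), so |x|^2 \<le> 2 and |x| < 3/2. The three solutions of L(y) = L(a) cannot all be that
  small.\<close>

lemma cyclo_mult_not_dvd_reflect:
  assumes "k > 0"
  shows "\<not> cyclo_mult k dvd pcompose (cyclo_mult k) [:0, -1:]"
proof
  assume dvd: "cyclo_mult k dvd pcompose (cyclo_mult k) [:0, -1:]"
  have small: "norm x < 3/2" if x: "evr mult_poly x \<in> prim_roots k" for x
  proof -
    have "evr (pcompose (cyclo_mult k) [:0, -1:]) x = 0"
      using evr_eq_0_if_dvd[OF dvd] x evr_cyclo_mult_eq_0_iff[OF assms] by simp
    then have "evr (cyclo_mult k) (- x) = 0" unfolding evr_simps(10) evr_minus_X .
    then have x': "evr mult_poly (- x) \<in> prim_roots k" using evr_cyclo_mult_eq_0_iff[OF assms] by simp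
    have "2 * (1 - x\<^sup>2) = evr mult_poly x + evr mult_poly (- x)"
      by (simp add: evr_mult_poly algebra_simps power2_eq_square)
    then have "norm (2 * (1 - x\<^sup>2)) \<le> 1 + 1"
      using norm_triangle_ineq[of "evr mult_poly x" "evr mult_poly (- x)"]
        prim_roots_norm[OF x assms] prim_roots_norm[OF x' assms] by simp
    then have "2 * norm (1 - x\<^sup>2) \<le> 2" by (simp only: norm_mult norm_numeral)
    then have "norm (x\<^sup>2) \<le> 2" using norm_triangle_ineq2[of "x\<^sup>2" 1] by (simp add: norm_minus_commute)
    moreover have "(3/2 :: real)\<^sup>2 = 9/4" by (simp add: power2_eq_square)
    ultimately have "(norm x)\<^sup>2 < (3/2)\<^sup>2" by (simp add: norm_power)
    then show ?thesis by (rule power2_less_imp_less) simp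
  qed
  obtain a where a: "evr mult_poly a \<in> prim_roots k" using cyclo_mult_has_root[OF assms] by blast
  \<comment> \<open>The discriminant of y^2 + (1 + a) y + (7 + a + a^2), which is (L(y) - L(a))/(y -
    a) up to sign; b and c below are its roots.\<close>
  define s where "s = csqrt ((1 + a)\<^sup>2 - 4 * (7 + a + a\<^sup>2))"
  have s: "s\<^sup>2 = (1 + a)\<^sup>2 - 4 * (7 + a + a\<^sup>2)" by (simp add: s_def)
  define b c where "b = (s - (1 + a)) / 2" and "c = (- s - (1 + a)) / 2"
  have b2: "2 * b = s - (1 + a)" and c2: "2 * c = - s - (1 + a)" by (simp_all add: b_def c_def)
  have "4 * (b * c) = (2 * b) * (2 * c)" by simp
  also have "\<dots> = (1 + a)\<^sup>2 - s\<^sup>2" unfolding b2 c2 by (simp add: algebra_simps power2_eq_square)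
  also have "\<dots> = 4 * (7 + a + a\<^sup>2)" unfolding s by simp
  finally have bc: "b * c = 7 + a + a\<^sup>2" by (simp only: mult_cancel_left) simp
  have "2 * (b + c) = 2 * - (1 + a)" unfolding distrib_left b2 c2 by simp
  then have sum: "b + c = - (1 + a)" by (simp only: mult_cancel_left) simp
  have quad: "evr mult_poly y = evr mult_poly a" if "y\<^sup>2 + (1 + a) * y + (7 + a + a\<^sup>2) = 0" for y
  proof -
    have "evr mult_poly y - evr mult_poly a = - (y - a) * (y\<^sup>2 + (1 + a) * y + (7 + a + a\<^sup>2))"
      by (simp add: evr_mult_poly algebra_simps power2_eq_square)
    then show ?thesis using that by simp
  qed
  have bq: "b\<^sup>2 + (1 + a) * b + (7 + a + a\<^sup>2) = 0" and cq: "c\<^sup>2 + (1 + a) * c + (7 + a + a\<^sup>2) = 0"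
  proof -
    have "b\<^sup>2 + (1 + a) * b + b * c = b * (b + c + (1 + a))" "c\<^sup>2 + (1 + a) * c + b * c = c * (b + c + (1 + a))"
      by (simp_all add: algebra_simps power2_eq_square)
    then show "b\<^sup>2 + (1 + a) * b + (7 + a + a\<^sup>2) = 0" "c\<^sup>2 + (1 + a) * c + (7 + a + a\<^sup>2) = 0"
      unfolding sum bc by simp_all
  qed
  have sm: "norm a < 3/2" "norm b < 3/2" "norm c < 3/2"
    using small[OF a] small[of b] small[of c] quad[OF bq] quad[OF cq] a by simp_all
  \<comment> \<open>The constant 7 = bc - a - a^2 would have modulus below 9/4 + 3/2 + 9/4 =
    6.\<close>
  have "norm (b * c) \<le> 3/2 * (3/2)" using sm unfolding norm_mult by (intro mult_mono) auto
  moreover have "norm (a\<^sup>2) \<le> 3/2 * (3/2)" using sm unfolding power2_eq_square norm_mult by (intro mult_mono) auto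
  moreover have "norm (b * c - a - a\<^sup>2) \<le> norm (b * c) + norm a + norm (a\<^sup>2)"
    using norm_triangle_ineq4[of "b * c - a" "a\<^sup>2"] norm_triangle_ineq4[of "b * c" a] by linarith
  moreover have "b * c - a - a\<^sup>2 = 7" unfolding bc by simp
  then have "norm (b * c - a - a\<^sup>2) = 7" by (simp only: norm_numeral)
  ultimately show False using sm(1) by linarith
qed

section \<open>Specialisation and dynatomic polynomials\<close>

lemma comm_ring_hom_evi: "comm_ring_hom (\<lambda>p. evi p c)"
  by unfold_locales auto

abbreviation spec :: "complex \<Rightarrow> int poly poly \<Rightarrow> complex poly" where
  "spec c \<equiv> map_poly (\<lambda>p. evi p c)"

lemma spec_pCons [simp]: "spec c (pCons a P) = pCons (evi a c) (spec c P)"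
proof -
  interpret h: comm_ring_hom "\<lambda>p. evi p c" by (rule comm_ring_hom_evi)
  show ?thesis by (rule h.map_poly_pCons_hom)
qed

lemma evi_pCons: "evi (pCons a P) c = of_int a + c * evi P c"
  by (simp add: hom_distribs)

lemma spec_1 [simp]: "spec c 1 = 1"
proof -
  interpret h: comm_ring_hom "\<lambda>p. evi p c" by (rule comm_ring_hom_evi)
  show ?thesis by (simp add: hom_distribs)
qed

lemma comm_ring_hom_spec: "comm_ring_hom (\<lambda>P. poly (spec c P) x)"
proof -
  interpret h: comm_ring_hom "\<lambda>p. evi p c" by (rule comm_ring_hom_evi)
  interpret mp: map_poly_comm_ring_hom "\<lambda>p. evi p c" ..
  show ?thesis by unfold_locales (simp_all add: mp.hom_add mp.hom_mult)
qed

lemma evi_ext: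
  assumes "\<And>c. evi P c = evi Q c"
  shows "P = Q"
proof -
  have "map_poly complex_of_int P = map_poly of_int Q"
    using assms by (simp add: poly_eq_poly_eq_iff[symmetric] fun_eq_iff)
  then show ?thesis by simp
qed

text \<open>Reduces identities in Z[c][x] to identities of complex numbers, where square roots are
  available to parametrise c by a fixed point or a cycle.\<close>

lemma spec_ext:
  assumes "\<And>c x. poly (spec c P) x = poly (spec c Q) x"
  shows "P = Q"
proof (rule poly_eqI)
  fix n
  have "spec c P = spec c Q" for c
    using assms by (simp add: poly_eq_poly_eq_iff[symmetric] fun_eq_iff)
  then have "coeff (spec c P) n = coeff (spec c Q) n" for c by simp
  then show "coeff P n = coeff Q n" by (intro evi_ext) (simp add: coeff_map_poly)
qed

text \<open>Leading coefficient 1 survives specialisation, so no degree drops and the Sylvester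
  matrix keeps its size.\<close>

lemma resultant_spec:
  assumes "lead_coeff P = 1" "lead_coeff Q = 1"
  shows "resultant (spec c P) (spec c Q) = evi (resultant P Q) c"
proof -
  interpret h: comm_ring_hom "\<lambda>p. evi p c" by (rule comm_ring_hom_evi)
  have deg: "degree (spec c R) = degree R" if "lead_coeff R = 1" for R
    by (rule map_poly_degree_eq) (use that in simp)
  show ?thesis by (rule h.resultant_map_poly) (rule deg, rule assms)+
qed

lemma map_poly_const_spec: "map_poly (\<lambda>P. poly (spec c P) x) (map_poly (\<lambda>a. [:a:]) R) = spec c R"
  by (subst map_poly_map_poly) (auto simp: o_def)

lemma moebius_mu_1 [simp]: "moebius_mu (Suc 0) = 1"
  by (simp add: moebius_mu_def)

lemma moebius_mu_prime: "prime p \<Longrightarrow> moebius_mu p = -1"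
  using moebius_mu_mult_prime[of p 1] by (simp add: prime_nat_iff)

lemma moebius_prod_1: "moebius_prod (Suc 0) g = g 1"
proof -
  have 1: "{j. j dvd Suc 0 \<and> moebius_mu (Suc 0 div j) = 1} = {1}" by auto
  have 2: "{j. j dvd Suc 0 \<and> moebius_mu (Suc 0 div j) = -1} = {}" by auto
  show ?thesis unfolding moebius_prod_def 1 2 by simp
qed

lemma moebius_prod_prime:
  assumes "prime p"
  shows "moebius_prod p g = g p div g 1"
proof -
  have p1: "p > 1" using assms by (rule prime_gt_1_nat)
  have 1: "{j. j dvd p \<and> moebius_mu (p div j) = 1} = {p}"
    using assms p1 moebius_mu_prime[OF assms] by (auto simp: prime_nat_iff)
  have 2: "{j. j dvd p \<and> moebius_mu (p div j) = -1} = {1}"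
    using assms p1 moebius_mu_prime[OF assms] by (auto simp: prime_nat_iff)
  show ?thesis unfolding moebius_prod_def 1 2 by simp
qed

text \<open>Makes the description in \<open>delta\<close> well defined. In d^n - e^n = (d - e) S the
  cofactor S has leading coefficient n, being a sum of n monic terms of equal degree.\<close>

lemma power_eq_imp_eq_monic:
  fixes d e :: "'a :: {idom, ring_char_0} poly"
  assumes "lead_coeff d = 1" "lead_coeff e = 1" "d ^ n = e ^ n" "n > 0"
  shows "d = e"
proof -
  have ne: "d \<noteq> 0" "e \<noteq> 0" using assms(1,2) by auto
  have "degree d * n = degree e * n"
    using arg_cong[OF assms(3), of degree] by (simp only: degree_power_eq[OF ne(1)] degree_power_eq[OF ne(2)])
  then have "degree d = degree e" using assms(4) by simp
  have "0 = d ^ n - e ^ n" using assms(3) by simp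
  also have "\<dots> = (d - e) * (\<Sum>i<n. e ^ (n - Suc i) * d ^ i)" by (rule power_diff_sumr2)
  finally have "d - e = 0 \<or> (\<Sum>i<n. e ^ (n - Suc i) * d ^ i) = 0" by (metis mult_eq_0_iff)
  moreover have "(\<Sum>i<n. e ^ (n - Suc i) * d ^ i) \<noteq> 0"
  proof -
    have "coeff (\<Sum>i<n. e ^ (n - Suc i) * d ^ i) ((n - 1) * degree d) = (\<Sum>i<n. 1)"
      unfolding coeff_sum
    proof (rule sum.cong[OF refl])
      fix i assume "i \<in> {..<n}"
      have "lead_coeff (e ^ (n - Suc i) * d ^ i) = 1"
        by (simp add: lead_coeff_mult lead_coeff_power assms)
      moreover have "degree (e ^ (n - Suc i) * d ^ i) = (n - Suc i) * degree e + i * degree d"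
        using ne by (simp add: degree_mult_eq degree_power_eq)
      moreover have "(n - Suc i) * degree e + i * degree d = (n - 1) * degree d"
        using \<open>i \<in> {..<n}\<close> \<open>degree d = degree e\<close> by (simp flip: add_mult_distrib)
      ultimately show "coeff (e ^ (n - Suc i) * d ^ i) ((n - 1) * degree d) = 1" by (simp only:)
    qed
    also have "\<dots> \<noteq> 0" using assms(4) by simp
    finally show ?thesis by auto
  qed
  ultimately show ?thesis by simp
qed

lemma delta_eqI:
  assumes "lead_coeff d = 1" "d ^ n = mult_res n" "n > 0"
  shows "delta n = d"
  unfolding delta_def using assms by (intro the_equality) (simp, metis power_eq_imp_eq_monic)

text \<open>The quotient (f^3(z) - z)/(f(z) - z), with f^3 the third iterate, expanded by powers of
  z with coefficients in Z[c].\<close>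

definition dynatomic3 :: "int poly poly" where
  "dynatomic3 = [: [:1, 1, 2, 1:], [:1, 2, 1:], [:1, 3, 3:], [:1, 2:], [:1, 3:], 1, 1 :]"

lemma poly_spec_fc_iter: "poly (spec c (fc_iter (Suc n))) z = (poly (spec c (fc_iter n)) z)\<^sup>2 + c"
proof -
  interpret h: comm_ring_hom "\<lambda>p. evi p c" by (rule comm_ring_hom_evi)
  have "spec c (fc_iter (Suc n)) = pcompose (spec c fc) (spec c (fc_iter n))"
    by (simp add: h.map_poly_pcompose)
  then show ?thesis by (simp add: poly_pcompose fc_def hom_distribs power2_eq_square)
qed

lemma poly_spec_fc_iter_0: "poly (spec c (fc_iter 0)) z = z"
  by (simp add: hom_distribs)

lemma poly_spec_fc_iter_1: "poly (spec c (fc_iter 1)) x = x\<^sup>2 + c"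
  unfolding One_nat_def poly_spec_fc_iter poly_spec_fc_iter_0 ..

lemma poly_spec_fc_iter_3: "poly (spec c (fc_iter 3)) x = ((x\<^sup>2 + c)\<^sup>2 + c)\<^sup>2 + c"
  unfolding numeral_3_eq_3 poly_spec_fc_iter poly_spec_fc_iter_0 ..

lemma dynatomic_1: "dynatomic 1 = [: [:0, 1:], -1, 1:]"
proof -
  have "fc_iter 1 - [:0, 1:] = [: [:0, 1:], -1, 1:]"
  proof (rule spec_ext)
    fix c x
    interpret H: comm_ring_hom "\<lambda>P. poly (spec c P) x" by (rule comm_ring_hom_spec)
    show "poly (spec c (fc_iter 1 - [:0, 1:])) x = poly (spec c [: [:0, 1:], -1, 1:]) x"
      unfolding H.hom_minus poly_spec_fc_iter_1 by (simp add: evi_pCons algebra_simps power2_eq_square)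
  qed
  then show ?thesis unfolding dynatomic_def by (simp add: moebius_prod_1)
qed

lemma poly_spec_dynatomic3: "poly (spec c dynatomic3) x =
  (c^3 + 2*c^2 + c + 1) + (c^2 + 2*c + 1) * x + (3*c^2 + 3*c + 1) * x^2
      + (2*c + 1) * x^3 + (3*c + 1) * x^4 + x^5 + x^6"
  unfolding dynatomic3_def spec_pCons evi_pCons spec_1 evi_simps(8) poly_pCons poly_1 by (simp add: algebra_simps power_numeral_reduce)

lemma dynatomic_3: "dynatomic 3 = dynatomic3"
proof -
  have eq: "fc_iter 3 - [:0, 1:] = dynatomic3 * (fc_iter 1 - [:0, 1:])"
  proof (rule spec_ext)
    fix c x
    interpret H: comm_ring_hom "\<lambda>P. poly (spec c P) x" by (rule comm_ring_hom_spec)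
    have X: "poly (spec c [:0, 1:]) x = x" by simp
    show "poly (spec c (fc_iter 3 - [:0, 1:])) x = poly (spec c (dynatomic3 * (fc_iter 1 - [:0, 1:]))) x"
      unfolding H.hom_mult H.hom_minus X poly_spec_dynatomic3 poly_spec_fc_iter_1 poly_spec_fc_iter_3
      by (simp add: algebra_simps power_numeral_reduce)
  qed
  have "dynatomic 1 \<noteq> 0" unfolding dynatomic_1 by simp
  then have nz: "fc_iter 1 - [:0, 1:] \<noteq> 0" by (simp add: dynatomic_def moebius_prod_1)
  have "dynatomic 3 = (fc_iter 3 - [:0, 1:]) div (fc_iter 1 - [:0, 1:])"
    unfolding dynatomic_def by (rule moebius_prod_prime) simp
  also have "\<dots> = dynatomic3" unfolding eq by (rule nonzero_mult_div_cancel_right[OF nz])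
  finally show ?thesis .
qed

section \<open>Multiplier polynomials of periods 1 and 3\<close>

lemma evi_numeral [simp]: "evi (numeral n) c = numeral n"
  by (simp only: numeral_poly evi_simps(6)) simp

lemma spec_fc_iter_Suc: "spec c (fc_iter (Suc n)) = (spec c (fc_iter n))\<^sup>2 + [:c:]"
  by (intro poly_ext) (simp add: poly_spec_fc_iter del: fc_iter.simps)

lemma degree_fc_iter: "degree (fc_iter n) = 2 ^ n \<and> lead_coeff (fc_iter n) = 1"
proof (induction n)
  case (Suc n)
  have fc: "degree fc = 2" "lead_coeff fc = 1" by (simp_all add: fc_def)
  have "degree (fc_iter (Suc n)) = 2 * 2 ^ n" using Suc fc by (simp add: degree_pcompose)
  moreover have "coeff (fc_iter n) (2 ^ n) = 1" using Suc by (metis (no_types))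
  then have "lead_coeff (fc_iter (Suc n)) = 1"
    using Suc fc lead_coeff_comp[of "fc_iter n" fc] by simp
  ultimately show ?case by simp
qed simp

lemma degree_spec: "lead_coeff P = 1 \<Longrightarrow> degree (spec c P) = degree P"
  by (rule map_poly_degree_eq) simp

text \<open>Poisson's formula after specialising c and x. For n > 0 the derivative of the iterate is
  nonconstant, so the constant x does not affect the degree and the resultant commutes with the
  specialisation.\<close>

lemma spec_mult_res:
  assumes n: "n > 0" and d: "lead_coeff (dynatomic n) = 1"
  shows "poly (spec c (mult_res n)) x =
    (\<Prod>y\<in>#proots (spec c (dynatomic n)). x - poly (pderiv (spec c (fc_iter n))) y)"
proof -
  interpret H: comm_ring_hom "\<lambda>P. poly (spec c P) x" by (rule comm_ring_hom_spec)
  interpret h: comm_ring_hom "\<lambda>p. evi p c" by (rule comm_ring_hom_evi)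
  interpret MH: map_poly_comm_ring_hom "\<lambda>P. poly (spec c P) x" ..
  let ?const = "map_poly (\<lambda>a :: int poly. [:a:])"
  have degc: "degree (?const R) = degree R" for R :: "int poly poly"
    by (rule degree_map_poly) auto
  let ?A = "?const (dynatomic n)"
  let ?B = "[: [:0, 1:] :] - ?const (pderiv (fc_iter n))"
  have mA: "map_poly (\<lambda>P. poly (spec c P) x) ?A = spec c (dynatomic n)"
    by (rule map_poly_const_spec)
  have sp: "spec c (pderiv (fc_iter n)) = pderiv (spec c (fc_iter n))"
    by (intro poly_eqI) (simp add: coeff_pderiv coeff_map_poly of_nat_poly)
  have mB: "map_poly (\<lambda>P. poly (spec c P) x) ?B = [:x:] - pderiv (spec c (fc_iter n))"
    unfolding MH.hom_minus map_poly_const_spec sp by (simp add: H.map_poly_pCons_hom)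
  have pos: "degree (pderiv (fc_iter n)) > 0" "degree (pderiv (spec c (fc_iter n))) = degree (pderiv (fc_iter n))"
    using conjunct1[OF degree_fc_iter[of n]] degree_spec[OF conjunct2[OF degree_fc_iter[of n]], of c]
      one_less_power[of "2 :: nat" n] n
    by (simp_all add: degree_pderiv)
  have dB: "degree (u - v) = degree v" if "degree u = 0" "degree v > 0" for u v :: "'a :: ab_group_add poly"
    using that degree_add_eq_right[of u "- v"] by simp
  have "poly (spec c (mult_res n)) x = resultant (spec c (dynatomic n)) ([:x:] - pderiv (spec c (fc_iter n)))"
    unfolding mult_res_def mA[symmetric] mB[symmetric]
  proof (rule H.resultant_map_poly[symmetric])
    show "degree (map_poly (\<lambda>P. poly (spec c P) x) ?A) = degree ?A"
      unfolding mA degc by (rule degree_spec[OF d])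
    have "degree ?B = degree (pderiv (fc_iter n))" using pos by (subst dB) (simp_all add: degc)
    moreover have "degree ([:x:] - pderiv (spec c (fc_iter n))) = degree (pderiv (fc_iter n))"
      using pos by (subst dB) simp_all
    ultimately show "degree (map_poly (\<lambda>P. poly (spec c P) x) ?B) = degree ?B" unfolding mB by simp
  qed
  also have "\<dots> = (\<Prod>y\<in>#proots (spec c (dynatomic n)). poly ([:x:] - pderiv (spec c (fc_iter n))) y)"
  proof -
    have lc: "lead_coeff (spec c (dynatomic n)) = 1"
      using degree_spec[OF d, of c] d by (simp add: coeff_map_poly)
    then have "spec c (dynatomic n) \<noteq> 0" by (metis leading_coeff_0_iff zero_neq_one)
    from resultant_eq_prod_proots[OF this] show ?thesis by (simp only: lc) simp
  qed
  finally show ?thesis by simp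
qed

lemma prod_mset_const_on:
  fixes a :: "'a :: comm_monoid_mult"
  assumes "\<And>y. y \<in># M \<Longrightarrow> f y = a"
  shows "(\<Prod>y\<in>#M. f y) = a ^ size M"
  using assms by (induction M) auto

lemma delta_1: "delta 1 = [: [:0, 4:], -2, 1:]"
proof (rule delta_eqI)
  have "mult_res 1 = [: [:0, 4:], -2, 1:]"
  proof (rule spec_ext)
    fix c x
    \<comment> \<open>y is a fixed point, so c = y - y^2. The other fixed point is 1 - y, and the
      multipliers are 2y and 2(1 - y).\<close>
    define y where "y = (1 + csqrt (1 - 4 * c)) / 2"
    have "(2 * y - 1)\<^sup>2 = 1 - 4 * c" by (simp add: y_def)
    then have "4 * c = 4 * (y - y\<^sup>2)" by (simp add: algebra_simps power2_eq_square)
    then have c: "c = y - y\<^sup>2" by (simp only: mult_cancel_left) simp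
    have "spec c (dynatomic 1) = [:-y, 1:] * [:-(1 - y), 1:]"
      unfolding dynatomic_1 c by (intro poly_ext) (simp add: evi_pCons algebra_simps power2_eq_square)
    then have "proots (spec c (dynatomic 1)) = proots ([:-y, 1:] * [:-(1 - y), 1:])" by (simp only:)
    also have "\<dots> = proots [:-y, 1:] + proots [:-(1 - y), 1:]" by (rule proots_mult) simp_all
    also have "\<dots> = {#y, 1 - y#}" by (simp only: proots_linear_factor) simp
    finally have pr: "proots (spec c (dynatomic 1)) = {#y, 1 - y#}" .
    have pd: "pderiv (spec c (fc_iter 1)) = [:0, 2:]"
      unfolding One_nat_def spec_fc_iter_Suc by (simp add: power2_eq_square pderiv_mult pderiv_add pderiv_pCons numeral_poly)
    have n1: "0 < (1 :: nat)" by simp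
    have lc: "lead_coeff (dynatomic 1) = 1" unfolding dynatomic_1 by simp
    have "poly (spec c (mult_res 1)) x = (x - 2 * y) * (x - 2 * (1 - y))"
      unfolding spec_mult_res[OF n1 lc] pr pd by (simp add: mult_ac)
    then show "poly (spec c (mult_res 1)) x = poly (spec c [: [:0, 4:], -2, 1:]) x"
      by (simp add: evi_pCons c algebra_simps power2_eq_square)
  qed
  then show "[: [:0, 4:], -2, 1:] ^ 1 = mult_res 1" by simp
qed simp_all

text \<open>The monic quadratic in x whose roots are the multipliers of the two 3-cycles.\<close>

definition delta3 :: "int poly poly" where
  "delta3 = [: [:64, 64, 128, 64:], [:-16, -8:], 1 :]"

text \<open>The cycles of length 3 become rational over the double cover of the parameter plane ramified at
  $c = -7/4$.  With $w$ the sum of the points of one cycle, $-1 - w$ is the sum for the other one.\<close>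

definition par :: "complex \<Rightarrow> complex" where "par w = - (w\<^sup>2 + w + 2)"

text \<open>By the chain rule a 3-cycle has multiplier 8 times the product of its points, and that
  product is minus the constant coefficient of \<open>cycle3 w\<close>.\<close>

definition mult3 :: "complex \<Rightarrow> complex" where "mult3 w = - 8 * (1 + 3 * w + 2 * w\<^sup>2 + w^3)"

text \<open>The cubic of the cycle with sum w. Summing z_(i+1) = z_i^2 + c over the cycle gives w =
  w^2 - 2 e + 3c, which determines the coefficient e of z.\<close>

definition cycle3 :: "complex \<Rightarrow> complex poly" where
  "cycle3 w = [: 1 + 3 * w + 2 * w\<^sup>2 + w^3, - (3 + 2 * w + w\<^sup>2), - w, 1 :]"

lemma par_surj: "\<exists>w. c = par w"
proof -
  define w where "w = (csqrt (- 4 * c - 7) - 1) / 2"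
  have "(2 * w + 1)\<^sup>2 = - 4 * c - 7" by (simp add: w_def)
  then have "4 * c = - 7 - (2 * w + 1)\<^sup>2" by simp
  also have "\<dots> = 4 * par w" by (simp add: par_def algebra_simps power2_eq_square)
  finally have "4 * c = 4 * par w" .
  then show ?thesis by (intro exI[of _ w]) (simp only: mult_cancel_left, simp)
qed

lemma spec_delta3: "poly (spec (par w) delta3) x = (x - mult3 w) * (x - mult3 (- 1 - w))"
proof -
  have d: "poly (spec c delta3) x = x\<^sup>2 - (16 + 8 * c) * x + 64 * (c^3 + 2 * c\<^sup>2 + c + 1)" for c
    by (simp add: delta3_def evi_pCons algebra_simps power_numeral_reduce)
  show ?thesis
    unfolding d unfolding par_def mult3_def by (simp add: algebra_simps power_numeral_reduce)
qed

lemma spec_dynatomic3_eq: "spec (par w) dynatomic3 = cycle3 w * cycle3 (- 1 - w)"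
  by (intro poly_ext)
    (simp add: poly_spec_dynatomic3 cycle3_def par_def algebra_simps power_numeral_reduce)

lemma multiplier_on_cycle3:
  assumes "poly (cycle3 w) z = 0"
  shows "poly (pderiv (spec (par w) (fc_iter 3))) z = mult3 w"
proof -
  define c where "c = par w"
  have "poly (pderiv (spec c (fc_iter 3))) z = 8 * z * (z\<^sup>2 + c) * ((z\<^sup>2 + c)\<^sup>2 + c)"
    unfolding numeral_3_eq_3 spec_fc_iter_Suc
    by (simp add: pderiv_add pderiv_pCons pderiv_mult power2_eq_square algebra_simps)
  \<comment> \<open>The cofactor is the quotient of the left side by \<open>cycle3 w\<close>;
    expanding the product certifies it.\<close>
  moreover have "8 * z * (z\<^sup>2 + c) * ((z\<^sup>2 + c)\<^sup>2 + c) - mult3 w = poly (cycle3 w) z *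
    (8 * (1 - (1 + 3 * w + w\<^sup>2 + w^3) * z - (3 + w + w\<^sup>2) * z\<^sup>2 + w * z^3 + z^4))"
    unfolding c_def par_def cycle3_def mult3_def by (simp add: algebra_simps power_numeral_reduce)
  ultimately show ?thesis unfolding assms c_def by (simp only: mult_zero_left right_minus_eq)
qed

text \<open>The multiplier is constant on the three roots of each cubic, so each cubic contributes
  the cube of one linear factor to the resultant.\<close>

lemma delta_3: "delta 3 = delta3"
proof (rule delta_eqI)
  show "delta3 ^ 3 = mult_res 3"
  proof (rule spec_ext)
    fix c x
    obtain w where c: "c = par w" using par_surj by blast
    interpret H: comm_ring_hom "\<lambda>P. poly (spec c P) x" by (rule comm_ring_hom_spec)
    have lc: "lead_coeff (dynatomic 3) = 1" unfolding dynatomic_3 dynatomic3_def by simp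
    have cy: "cycle3 s \<noteq> 0" "degree (cycle3 s) = 3" for s by (simp_all add: cycle3_def)
    have pr: "proots (spec c (dynatomic 3)) = proots (cycle3 w) + proots (cycle3 (- 1 - w))"
      unfolding dynatomic_3 c spec_dynatomic3_eq by (rule proots_mult) (rule cy)+
    have P: "(\<Prod>y\<in>#proots (cycle3 s). x - poly (pderiv (spec c (fc_iter 3))) y) = (x - mult3 s) ^ 3"
      if "c = par s" for s
    proof -
      have "(\<Prod>y\<in>#proots (cycle3 s). x - poly (pderiv (spec c (fc_iter 3))) y) =
        (x - mult3 s) ^ size (proots (cycle3 s))"
      proof (rule prod_mset_const_on)
        fix y assume "y \<in># proots (cycle3 s)"
        then have "poly (cycle3 s) y = 0" using cy by simp
        then show "x - poly (pderiv (spec c (fc_iter 3))) y = x - mult3 s"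
          unfolding that by (subst multiplier_on_cycle3) auto
      qed
      then show ?thesis by (simp only: size_proots_complex cy)
    qed
    have c': "c = par (- 1 - w)" unfolding c by (simp add: par_def algebra_simps power2_eq_square)
    have "poly (spec c (mult_res 3)) x = (x - mult3 w) ^ 3 * (x - mult3 (- 1 - w)) ^ 3"
      unfolding spec_mult_res[OF zero_less_numeral lc] pr image_mset_union prod_mset.union P[OF c] P[OF c'] ..
    also have "\<dots> = poly (spec c delta3) x ^ 3"
      unfolding c spec_delta3 by (simp only: power_mult_distrib)
    finally show "poly (spec c (delta3 ^ 3)) x = poly (spec c (mult_res 3)) x"
      by (simp only: H.hom_power)
  qed
qed (simp_all add: delta3_def)

section \<open>The delta factors\<close>

lemma evi_resultant_cyclo:
  assumes "k > 0" "lead_coeff D = 1"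
  shows "evi (resultant (map_poly (\<lambda>a. [:a:]) (cyclo k)) D) c = (\<Prod>z\<in>prim_roots k. poly (spec c D) z)"
proof -
  let ?C = "map_poly (\<lambda>a. [:a:]) (cyclo k)"
  have deg: "degree ?C = degree (cyclo k)" by (rule degree_map_poly) auto
  have "lead_coeff ?C = [:lead_coeff (cyclo k):]"
    unfolding deg by (rule coeff_map_poly) simp
  then have lc: "lead_coeff ?C = 1" unfolding lead_coeff_cyclo[OF assms(1)] by simp
  have sp: "spec c ?C = cyclo_c k"
    by (subst map_poly_map_poly) (auto simp: o_def simp flip: map_poly_cyclo[OF assms(1)])
  have "evi (resultant ?C D) c = resultant (cyclo_c k) (spec c D)"
    using resultant_spec[OF lc assms(2), of c] unfolding sp by (rule sym)
  also have "\<dots> = (\<Prod>z\<in>#mset_set (prim_roots k). poly (spec c D) z)"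
  proof -
    have "cyclo_c k \<noteq> 0" using lead_coeff_cyclo_c[of k] by auto
    from resultant_eq_prod_proots[OF this] show ?thesis
      unfolding lead_coeff_cyclo_c proots_cyclo_c[OF assms(1)] by simp
  qed
  finally show ?thesis by (simp add: prod_unfold_prod_mset)
qed

lemma lead_coeff_delta3: "lead_coeff delta3 = 1"
  by (simp add: delta3_def)

lemma mult_poly_eq_mult3: "evr mult_poly (2 * w + 1) = mult3 w" "evr mult_poly (- (2 * w + 1)) = mult3 (- 1 - w)"
  by (simp_all add: evr_mult_poly mult3_def algebra_simps power_numeral_reduce)

section \<open>Pulling back along the double cover\<close>

lemma evr_ext:
  assumes "\<And>x. evr P x = evr Q x"
  shows "P = Q"
proof -
  have "map_poly of_rat P = (map_poly of_rat Q :: complex poly)"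
    using assms by (intro poly_ext)
  then have "coeff (map_poly of_rat P :: complex poly) n = coeff (map_poly of_rat Q) n" for n by simp
  then show ?thesis by (intro poly_eqI) simp
qed

lemma evr_pCons: "evr (pCons a P) x = of_rat a + x * evr P x"
  by (simp add: of_rat_hom.map_poly_pCons_hom)

definition par_poly :: "rat poly" where "par_poly = [:-7/4, 0, -1/4:]"

lemma evr_par_poly: "4 * evr par_poly x = - (x\<^sup>2 + 7)"
  unfolding par_poly_def evr_pCons
  by (simp add: of_rat_divide of_rat_minus of_rat_numeral_eq power2_eq_square)

lemma evr_par_poly_eq_par: "evr par_poly (2 * w + 1) = par w"
proof -
  have "4 * evr par_poly (2 * w + 1) = 4 * par w"
    unfolding evr_par_poly by (simp add: par_def algebra_simps power2_eq_square)
  then show ?thesis by (simp only: mult_cancel_left) simp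
qed

text \<open>At t = 2w + 1 the two multipliers are L(t) and L(-t). For k > 1 the indices 3k and 3
  differ, so \<open>Delta\<close> is the plain resultant. Signs cancel because the factors come in
  pairs.\<close>

lemma Delta_pcompose_par:
  assumes "k > 1"
  shows "pcompose (map_poly of_int (Delta (3 * k) 3)) par_poly = cyclo_mult k * pcompose (cyclo_mult k) [:0, -1:]"
proof (rule evr_ext)
  fix x :: complex
  have k0: "k > 0" using assms by simp
  define w where "w = (x - 1) / 2"
  have x: "x = 2 * w + 1" by (simp add: w_def)
  have D: "Delta (3 * k) 3 = resultant (map_poly (\<lambda>a. [:a:]) (cyclo k)) delta3"
    using assms by (simp add: Delta_def delta_3)
  have cm: "evr (cyclo_mult k) y = (\<Prod>z\<in>prim_roots k. evr mult_poly y - z)" for y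
    unfolding cyclo_mult_def evr_simps(10) map_poly_cyclo_rat[OF k0] poly_cyclo_c ..
  have "evr (pcompose (map_poly of_int (Delta (3 * k) 3)) par_poly) x =
    (\<Prod>z\<in>prim_roots k. (z - mult3 w) * (z - mult3 (- 1 - w)))"
    unfolding evr_simps(10) evr_of_int x evr_par_poly_eq_par D evi_resultant_cyclo[OF k0 lead_coeff_delta3] spec_delta3 ..
  also have "\<dots> = (\<Prod>z\<in>prim_roots k. (mult3 w - z) * (mult3 (- 1 - w) - z))"
    by (intro prod.cong) (auto simp: algebra_simps)
  also have "\<dots> = evr (cyclo_mult k) x * evr (cyclo_mult k) (- x)"
    unfolding cm x mult_poly_eq_mult3 by (rule prod.distrib)
  also have "\<dots> = evr (cyclo_mult k * pcompose (cyclo_mult k) [:0, -1:]) x"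
    unfolding evr_simps evr_minus_X ..
  finally show "evr (pcompose (map_poly of_int (Delta (3 * k) 3)) par_poly) x =
    evr (cyclo_mult k * pcompose (cyclo_mult k) [:0, -1:]) x" .
qed

lemma pcompose_reflect_reflect: "pcompose (pcompose P [:0, -1:]) [:0, -1 :: rat:] = P"
  by (rule evr_ext) (simp only: evr_simps evr_minus_X minus_minus)

lemma pcompose_par_reflect: "pcompose (pcompose A par_poly) [:0, -1:] = pcompose A par_poly"
proof (rule evr_ext)
  fix x :: complex
  have "4 * evr par_poly (- x) = 4 * evr par_poly x"
    unfolding evr_par_poly by simp
  then have "evr par_poly (- x) = evr par_poly x" by (simp only: mult_cancel_left) simp
  then show "evr (pcompose (pcompose A par_poly) [:0, -1:]) x = evr (pcompose A par_poly) x"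
    by (simp only: evr_simps evr_minus_X)
qed

text \<open>Descent from t to c: F divides the pullback of one factor A. This pullback is even, so
  F(-t) divides it too, and since F does not divide F(-t) so does their product. Nothing but a unit
  is left for the other factor.\<close>

lemma irreducible_Delta_ge_2:
  assumes "k > 1"
  shows "irreducible (map_poly of_int (Delta (3 * k) 3) :: rat poly)"
proof (rule irreducibleI)
  let ?P = "map_poly of_int (Delta (3 * k) 3) :: rat poly"
  let ?F = "cyclo_mult k" and ?R = "\<lambda>P. pcompose P [:0, -1 :: rat:]"
  have k0: "k > 0" using assms by simp
  note eq = Delta_pcompose_par[OF assms]
  have pF: "prime_elem ?F" by (rule prime_elem_cyclo_mult[OF assms])
  have unit: "is_unit B" if "pcompose B par_poly dvd 1" for B
  proof -
    have "degree (pcompose B par_poly) = 0" "pcompose B par_poly \<noteq> 0"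
      using that by (auto simp: poly_dvd_1)
    moreover have "degree par_poly = 2" by (simp add: par_poly_def)
    ultimately have "degree B = 0" "B \<noteq> 0" by (auto simp: degree_pcompose)
    then show ?thesis by (simp add: is_unit_iff_degree)
  qed
  have F0: "?F \<noteq> 0" using pF by auto
  then have RF0: "?R ?F \<noteq> 0" using pcompose_reflect_reflect[of ?F] by auto
  show "?P \<noteq> 0"
  proof
    assume "?P = 0"
    then have "?F * ?R ?F = 0" using eq by simp
    then show False using F0 RF0 by simp
  qed
  show "\<not> is_unit ?P"
  proof
    assume "is_unit ?P"
    then obtain p where "?P = [:p:]" by (metis is_unit_polyE)
    then have "degree (?F * ?R ?F) = 0" using eq by (metis degree_pCons_0 pcompose_const)
    then show False using degree_cyclo_mult_pos[OF k0] F0 RF0 by (simp add: degree_mult_eq)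
  qed
  have main: "is_unit B" if AB: "?P = A * B" and dvd: "?F dvd pcompose A par_poly" for A B
  proof -
    obtain C where C: "pcompose A par_poly = ?F * C" using dvd by auto
    have "pcompose A par_poly = ?R ?F * ?R C"
      using pcompose_par_reflect[of A] unfolding C by (simp add: pcompose_mult)
    then have "?F dvd ?R ?F * ?R C" using dvd by simp
    \<comment> \<open>Evenness writes the pullback of A also as F(-t) C(-t); F is prime and does not
      divide F(-t).\<close>
    then have "?F dvd ?R C" using pF cyclo_mult_not_dvd_reflect[OF k0] by (auto simp: prime_elem_dvd_mult_iff)
    then obtain E where E: "?R C = ?F * E" by auto
    have "C = ?R ?F * ?R E" using pcompose_reflect_reflect[of C] unfolding E by (simp add: pcompose_mult)
    then have A: "pcompose A par_poly = ?F * ?R ?F * ?R E" using C by (simp add: mult.assoc)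
    have "?F * ?R ?F = pcompose A par_poly * pcompose B par_poly"
      using eq unfolding AB by (simp add: pcompose_mult)
    also have "\<dots> = (?F * ?R ?F) * (?R E * pcompose B par_poly)" unfolding A by (simp only: mult.assoc)
    finally have "(?F * ?R ?F) * (?R E * pcompose B par_poly) = (?F * ?R ?F) * 1" by simp
    then have "?R E * pcompose B par_poly = 1" using F0 RF0 by (metis mult_left_cancel mult_eq_0_iff)
    then have "pcompose B par_poly dvd 1" by (metis dvd_triv_right)
    then show ?thesis by (rule unit)
  qed
  fix A B assume AB: "?P = A * B"
  have "pcompose A par_poly * pcompose B par_poly = ?F * ?R ?F"
    using eq unfolding AB by (simp add: pcompose_mult)
  then have "?F dvd pcompose A par_poly * pcompose B par_poly" by simp
  then have "?F dvd pcompose A par_poly \<or> ?F dvd pcompose B par_poly"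
    using pF by (simp only: prime_elem_dvd_mult_iff)
  then show "is_unit A \<or> is_unit B" using main[of A B] main[of B A] AB by (metis mult.commute)
qed

text \<open>The factor of \<open>delta 3\<close> at 1 coming from fixed points whose multiplier is a
  primitive cube root of unity. It is the product of z^2 - 2z + 4c over those two roots, reduced by
  w^2 = -1 - w.\<close>

lemma resultant_cyclo_3_delta_1:
  "resultant (map_poly (\<lambda>a. [:a:]) (cyclo 3)) (delta 1) = [:7, 4, 16:]"
proof (rule evi_ext)
  fix c
  define w where "w = cis (2 * pi / 3)"
  have w: "w \<in> prim_roots 3" using prim_roots_nonempty[of 3] by (simp add: w_def)
  then have w1: "w \<noteq> 1" "w\<^sup>2 \<noteq> 1" "w ^ 3 = 1"
    unfolding prim_roots_def by (auto dest: spec[of _ 1] spec[of _ 2])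
  have "(w - 1) * (w\<^sup>2 + w + 1) = w ^ 3 - 1" by (simp add: algebra_simps power_numeral_reduce)
  then have "w\<^sup>2 + w + 1 = 0" using w1 by simp
  then have w2: "w\<^sup>2 = - 1 - w" by (simp add: algebra_simps eq_neg_iff_add_eq_0)
  have w22: "w\<^sup>2 \<in> prim_roots 3" by (subst prim_roots_power[OF w]) (simp_all add: coprime_iff_gcd_eq_1 gcd_nat.simps)
  have "prim_roots 3 = {w, w\<^sup>2}"
  proof
    show "prim_roots 3 \<subseteq> {w, w\<^sup>2}"
    proof
      fix z assume z: "z \<in> prim_roots 3"
      then obtain j where j: "j < 3" "z = w ^ j"
        using prim_roots_generate[OF w, of z] by (auto simp: prim_roots_def)
      moreover have "z \<noteq> 1" using z by (auto simp: prim_roots_def dest: spec[of _ 1])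
      ultimately show "z \<in> {w, w\<^sup>2}" by (auto simp: less_Suc_eq numeral_3_eq_3 numeral_2_eq_2)
    qed
  qed (use w w22 in auto)
  moreover have "w \<noteq> w\<^sup>2" using w1 by (metis mult_cancel_right1 power2_eq_square power_zero_numeral w2 mult_zero_left zero_neq_one power_0_left)
  ultimately have "(\<Prod>z\<in>prim_roots 3. z\<^sup>2 - 2 * z + 4 * c) = (w\<^sup>2 - 2 * w + 4 * c) * ((w\<^sup>2)\<^sup>2 - 2 * w\<^sup>2 + 4 * c)"
    by simp
  also have "\<dots> = ((- 1 - w) - 2 * w + 4 * c) * ((- 1 - w)\<^sup>2 - 2 * (- 1 - w) + 4 * c)"
    unfolding w2 ..
  also have "\<dots> = (4 * c - 1 - 3 * w) * (w\<^sup>2 + 4 * w + 3 + 4 * c)" by (simp add: algebra_simps power2_eq_square)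
  also have "\<dots> = (4 * c - 1 - 3 * w) * (4 * c + 2 + 3 * w)" unfolding w2 by simp
  also have "\<dots> = 16 * c\<^sup>2 + 4 * c - 2 - 9 * w - 9 * w\<^sup>2" by (simp add: algebra_simps power2_eq_square)
  also have "\<dots> = 16 * c\<^sup>2 + 4 * c + 7" unfolding w2 by simp
  finally have prod: "(\<Prod>z\<in>prim_roots 3. z\<^sup>2 - 2 * z + 4 * c) = 16 * c\<^sup>2 + 4 * c + 7" .
  have lc: "lead_coeff (delta 1) = 1" unfolding delta_1 by simp
  have sp: "poly (spec c (delta 1)) z = z\<^sup>2 - 2 * z + 4 * c" for z
    unfolding delta_1 by (simp add: evi_pCons algebra_simps power2_eq_square)
  have "evi (resultant (map_poly (\<lambda>a. [:a:]) (cyclo 3)) (delta 1)) c = 16 * c\<^sup>2 + 4 * c + 7"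
    unfolding evi_resultant_cyclo[OF zero_less_numeral lc] sp prod ..
  then show "evi (resultant (map_poly (\<lambda>a. [:a:]) (cyclo 3)) (delta 1)) c = evi [:7, 4, 16:] c"
    by (simp add: evi_pCons algebra_simps power2_eq_square)
qed

text \<open>At x = 1 the period 3 multiplier polynomial is 64c^3 + 128c^2 + 56c + 49 = (4c +
  7)(16c^2 + 4c + 7). Dividing by the fixed point factor leaves 4c + 7.\<close>

lemma Delta_3_3: "Delta 3 3 = [:7, 4:]"
proof -
  have 1: "{m'. m' dvd 3 \<and> m' \<noteq> (3::nat)} = {1}"
    using prime_nat_iff[of 3] by auto
  have 2: "poly (delta 3) 1 = [:7, 4:] * [:7, 4, 16:]"
    unfolding delta_3 delta3_def by (rule evi_ext) (simp add: evi_pCons algebra_simps)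
  have 3: "resultant (map_poly (\<lambda>a. [:a:]) (cyclo (3 div 1))) (delta 1) = [:7, 4, 16:]"
    using resultant_cyclo_3_delta_1 by simp
  have "Delta 3 3 = ([:7, 4:] * [:7, 4, 16:]) div [:7, 4, 16:]"
    unfolding Delta_def 1 2 using 3 by simp
  also have "\<dots> = [:7, 4:]" by (rule nonzero_mult_div_cancel_right) simp
  finally show ?thesis .
qed

theorem theorem1p2:
  fixes k :: nat
  assumes "k \<ge> 1"
  shows "irreducible (map_poly (of_int :: int \<Rightarrow> rat) (Delta (3 * k) 3))"
proof (cases "k = 1")
  case True
  \<comment> \<open>For k = 1 the diagonal branch of \<open>Delta\<close> applies, and the result is
    linear.\<close>
  have "irreducible [:7, 4 :: rat:]" by (rule irreducible_linear_field_poly) simp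
  then show ?thesis using True by (simp add: Delta_3_3)
next
  case False
  then show ?thesis using assms by (intro irreducible_Delta_ge_2) simp
qed

end
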